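(* Let $G$ be a finite group. Then: (1) $\mathcal{RP}^*(G)$ is complete bipartite if and only if $G\cong\mathbb Z_{p^2}$ for some prime $p$, or $G\cong\mathbb Z_{pq}$ for some distinct primes $p,q$, or $G\cong Q_8$; (2) for each integer $k\ge 3$, $\mathcal{RP}^*(G)$ is complete $k$-partite if and only if $G\cong\mathbb Z_{p^k}$ for some prime $p$.
   Context: For a group $G$ with identity $e$, the reduced power graph $\mathcal{RP}(G)$ is the simple graph with vertex set $G$ in which $u,v$ are adjacent if and only if $\langle v\rangle\subset\langle u\rangle$ or $\langle u\rangle\subset\langle v\rangle$, where $\subset$ means proper inclusion. The proper reduced power graph $\mathcal{RP}^*(G)$ is the subgraph of $\mathcal{RP}(G)$ induced on $G\setminus\{e\}$. $Q_8$ is the quaternion group of order $8$. A complete $k$-partite graph is a graph $K_{n_1,\dots,n_k}$ with $k$ non-empty parts of sizes $n_1,\dots,n_k$, where two vertices are adjacent exactly when they lie in different parts; complete bipartite means complete $2$-partite. *)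

theory Defs
  imports
    "HOL-Algebra.Elementary_Groups"
    "HOL-Computational_Algebra.Primes"
    "HOL-Library.Disjoint_Sets"
    "Graph_Theory.Graph_Theory"
begin

section \<open>Reduced power graphs\<close>

text \<open>A simple graph is a symmetric loop-free digraph without parallel arcs (locale
  \<^locale>\<open>graph\<close>), each undirected edge being a pair of opposite arcs.\<close>

definition reduced_power_graph :: "('a, 'b) monoid_scheme \<Rightarrow> ('a, 'a \<times> 'a) pre_digraph" where
  "reduced_power_graph G = with_proj
     \<lparr>pverts = carrier G,
      parcs = {(u, v). u \<in> carrier G \<and> v \<in> carrier G \<and>
                (generate G {v} \<subset> generate G {u} \<or> generate G {u} \<subset> generate G {v})}\<rparr>"

definition proper_reduced_power_graph ::
    "('a, 'b) monoid_scheme \<Rightarrow> ('a, 'a \<times> 'a) pre_digraph" where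
  "proper_reduced_power_graph G = reduced_power_graph G \<restriction> (carrier G - {\<one>\<^bsub>G\<^esub>})"

lemma graph_reduced_power_graph:
  assumes "finite (carrier G)"
  shows "graph (reduced_power_graph G)"
proof
  show "finite (arcs (reduced_power_graph G))"
    by (rule finite_subset[of _ "carrier G \<times> carrier G"])
      (use assms in \<open>auto simp: reduced_power_graph_def\<close>)
qed (use assms in \<open>auto simp: reduced_power_graph_def symmetric_def arc_to_ends_def sym_def\<close>)

lemma graph_proper_reduced_power_graph:
  assumes "finite (carrier G)"
  shows "graph (proper_reduced_power_graph G)"
proof
  show "finite (arcs (proper_reduced_power_graph G))"
    by (rule finite_subset[of _ "carrier G \<times> carrier G"])
      (use assms in \<open>auto simp: proper_reduced_power_graph_def reduced_power_graph_def\<close>)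
qed (use assms in \<open>auto simp: proper_reduced_power_graph_def reduced_power_graph_def
       symmetric_def arc_to_ends_def arcs_ends_conv sym_def\<close>)

section \<open>Complete multipartite graphs\<close>

text \<open>The blocks of a partition in the sense of \<^const>\<open>partition_on\<close> are non-empty.\<close>

definition complete_multipartite :: "nat \<Rightarrow> ('a, 'b) pre_digraph \<Rightarrow> bool" where
  "complete_multipartite k H \<longleftrightarrow> graph H \<and>
     (\<exists>P. partition_on (verts H) P \<and> finite P \<and> card P = k \<and>
          arcs_ends H = {(u, v). \<exists>U\<in>P. \<exists>V\<in>P. U \<noteq> V \<and> u \<in> U \<and> v \<in> V})"

abbreviation complete_bipartite :: "('a, 'b) pre_digraph \<Rightarrow> bool" where
  "complete_bipartite H \<equiv> complete_multipartite 2 H"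

lemma complete_bipartite_iff:
  "complete_bipartite H \<longleftrightarrow> (\<exists>m>0. \<exists>n>0. complete_bipartite_digraph m n H)"
proof
  assume "complete_bipartite H"
  then obtain P where H: "graph H" and P: "partition_on (verts H) P" "card P = 2"
    "arcs_ends H = {(u, v). \<exists>U\<in>P. \<exists>V\<in>P. U \<noteq> V \<and> u \<in> U \<and> v \<in> V}"
    by (auto simp: complete_multipartite_def)
  interpret graph H by fact
  obtain U V where UV: "P = {U, V}" "U \<noteq> V"
    using P(2) by (auto simp: card_2_iff)
  have 1: "verts H = U \<union> V" "U \<inter> V = {}" "U \<noteq> {}" "V \<noteq> {}"
    using P(1) UV by (auto simp: partition_on_def disjoint_def)
  have 2: "arcs_ends H = U \<times> V \<union> V \<times> U"
    using P(3) UV by auto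
  have "finite U" "finite V"
    using finite_verts 1(1) by auto
  then show "\<exists>m>0. \<exists>n>0. complete_bipartite_digraph m n H"
    using H 1 2 unfolding complete_bipartite_digraph_def
    by (metis card_gt_0_iff)
next
  assume "\<exists>m>0. \<exists>n>0. complete_bipartite_digraph m n H"
  then obtain U V where H: "graph H" "verts H = U \<union> V" "U \<inter> V = {}"
    "card U > 0" "card V > 0" "arcs_ends H = U \<times> V \<union> V \<times> U"
    by (auto simp: complete_bipartite_digraph_def)
  have ne: "U \<noteq> {}" "V \<noteq> {}" "U \<noteq> V"
    using H(3-5) by auto
  have "partition_on (verts H) {U, V}"
    using H(2,3) ne by (auto simp: partition_on_def disjoint_def)
  moreover have "arcs_ends H =
      {(u, v). \<exists>A\<in>{U, V}. \<exists>B\<in>{U, V}. A \<noteq> B \<and> u \<in> A \<and> v \<in> B}"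
    using H(6) ne by auto
  moreover have "card {U, V} = 2"
    using ne by simp
  ultimately show "complete_bipartite H"
    using H(1) unfolding complete_multipartite_def by blast
qed

section \<open>The quaternion group of order 8\<close>

text \<open>\<open>(a, b, c, d)\<close> stands for the quaternion \<open>a + b i + c j + d k\<close>; the group consists of
  the units \<open>1, -1, i, -i, j, -j, k, -k\<close> under Hamilton's product.\<close>

fun hamilton_mult ::
    "int \<times> int \<times> int \<times> int \<Rightarrow> int \<times> int \<times> int \<times> int \<Rightarrow> int \<times> int \<times> int \<times> int" where
  "hamilton_mult (a, b, c, d) (a', b', c', d') =
     (a * a' - b * b' - c * c' - d * d',
      a * b' + b * a' + c * d' - d * c',
      a * c' - b * d' + c * a' + d * b',
      a * d' + b * c' - c * b' + d * a')"

definition Q8 :: "(int \<times> int \<times> int \<times> int) monoid" where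
  "Q8 = \<lparr>carrier = {(1, 0, 0, 0), (-1, 0, 0, 0), (0, 1, 0, 0), (0, -1, 0, 0),
                    (0, 0, 1, 0), (0, 0, -1, 0), (0, 0, 0, 1), (0, 0, 0, -1)},
         monoid.mult = hamilton_mult, one = (1, 0, 0, 0)\<rparr>"

lemma group_Q8: "group Q8"
proof (rule groupI)
  fix x y z
  show "x \<otimes>\<^bsub>Q8\<^esub> y \<otimes>\<^bsub>Q8\<^esub> z = x \<otimes>\<^bsub>Q8\<^esub> (y \<otimes>\<^bsub>Q8\<^esub> z)"
    by (cases x; cases y; cases z) (simp add: Q8_def algebra_simps)
qed (auto simp: Q8_def)

lemma order_Q8: "order Q8 = 8"
  by (simp add: order_def Q8_def)

end

theory Submission
  imports Defs "HOL-Algebra.Sylow" "HOL-Algebra.Multiplicative_Group"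
begin

text \<open>
  In a complete multipartite graph non-adjacency is an equivalence relation whose classes are the
  parts. Two elements of equal order are never adjacent, so transitivity of non-adjacency forces
  containments. Let \<open>x\<close> and \<open>y\<close> be non-trivial.

  If \<open>ord x\<close> properly divides \<open>ord y\<close>, then \<open>x \<in> \<langle>y\<rangle>\<close>: otherwise \<open>x\<close> is not adjacent to \<open>y\<close>, hence,
  like \<open>y\<close>, adjacent to the elements of order \<open>ord x\<close> in \<open>\<langle>y\<rangle>\<close>, which is absurd
  (\<open>mem_generate_of_ord_dvd\<close>). By the same argument an element of prime order lies in every
  \<open>\<langle>x\<rangle>\<close> with \<open>ord x\<close> not prime (\<open>prime_ord_mem_generate\<close>). With at least two parts there is an
  edge, hence some \<open>x \<noteq> 1\<close> whose order is not prime.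

  If two distinct primes \<open>p\<close>, \<open>q\<close> divide the order of one element, the second containment leaves no
  room for a third prime or for an element of order \<open>p\<^sup>2\<close> or \<open>q\<^sup>2\<close>, and the group is cyclic of
  order \<open>pq\<close> (\<open>cyclic_of_ord_prod_two_primes\<close>).

  Otherwise all orders are powers of a single prime \<open>p\<close>. The parts are then the sets of elements of
  a given order, so the largest order is \<open>p\<^sup>k\<close>, where \<open>k\<close> is the number of parts. Suppose that
  the group is not generated by an element of order \<open>p\<^sup>k\<close>. By Sylow's theorem some subgroup of order
  \<open>p\<^bsup>k+1\<^esup>\<close> exists. It contains an element \<open>s\<close> of order \<open>p\<^sup>k\<close> and some \<open>g \<notin> \<langle>s\<rangle>\<close>, which
  normalises \<open>\<langle>s\<rangle>\<close> because the index is \<open>p\<close>. Choose \<open>u \<in> \<langle>s\<rangle>\<close> with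
  \<open>u\<^sup>p = g\<^bsup>-p\<^esup>\<close>. The commutator \<open>c\<close> of \<open>u\<close> and \<open>g\<close> commutes with both and satisfies
  \<open>c\<^sup>p = 1\<close>, so \<open>(gu)\<^sup>p = c\<^bsup>p(p-1)/2\<^esup>\<close>. As \<open>gu \<notin> \<langle>s\<rangle>\<close> has order \<open>p\<^sup>k\<close>, this forces
  \<open>p = 2\<close> and \<open>k = 2\<close> (\<open>p_group_cyclic_or_exponent_four\<close>). In that case all elements other than
  \<open>1\<close> and a single involution \<open>c\<close> square to \<open>c\<close>, and any two of them that generate different
  subgroups satisfy \<open>yx = cxy\<close>. That leaves only \<open>Q\<^sub>8\<close>
  (\<open>squares_to_involution_imp_Q8_iso\<close>).

  Conversely, for each group listed the adjacency is described by an explicit function on the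
  non-trivial elements, which shows the parts.
\<close>

section \<open>Colourings of the proper reduced power graph\<close>

text \<open>The adjacency relation of the reduced power graph, on arbitrary elements.\<close>

definition power_adj :: "('a, 'b) monoid_scheme \<Rightarrow> 'a \<Rightarrow> 'a \<Rightarrow> bool" where
  "power_adj G u v \<longleftrightarrow>
     generate G {v} \<subset> generate G {u} \<or> generate G {u} \<subset> generate G {v}"

text \<open>A complete multipartite structure is encoded by a function \<open>f\<close> whose fibres on the
  non-trivial elements are the parts: two such elements are adjacent exactly when \<open>f\<close> separates
  them. The number of parts is the number of values of \<open>f\<close> there.\<close>

definition rpg_colouring :: "('a, 'b) monoid_scheme \<Rightarrow> ('a \<Rightarrow> 'c) \<Rightarrow> bool" where
  "rpg_colouring G f \<longleftrightarrow> (\<forall>u \<in> carrier G - {\<one>\<^bsub>G\<^esub>}. \<forall>v \<in> carrier G - {\<one>\<^bsub>G\<^esub>}.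
     power_adj G u v \<longleftrightarrow> f u \<noteq> f v)"

text \<open>If the graph is complete multipartite, this is the part containing \<open>u\<close>.\<close>

definition non_neighbours :: "('a, 'b) monoid_scheme \<Rightarrow> 'a \<Rightarrow> 'a set" where
  "non_neighbours G u = {v \<in> carrier G - {\<one>\<^bsub>G\<^esub>}. \<not> power_adj G u v}"

lemma verts_proper_reduced_power_graph:
  "verts (proper_reduced_power_graph G) = carrier G - {\<one>\<^bsub>G\<^esub>}"
  by (simp add: proper_reduced_power_graph_def)

lemma arcs_ends_proper_reduced_power_graph:
  "arcs_ends (proper_reduced_power_graph G) =
     {(u, v). u \<in> carrier G - {\<one>\<^bsub>G\<^esub>} \<and> v \<in> carrier G - {\<one>\<^bsub>G\<^esub>} \<and> power_adj G u v}"
  by (auto simp: proper_reduced_power_graph_def reduced_power_graph_def arcs_ends_conv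
      power_adj_def)

lemma complete_multipartite_imp_colouring:
  assumes "complete_multipartite k (proper_reduced_power_graph G)"
  shows "rpg_colouring G (non_neighbours G)"
    and "card (non_neighbours G ` (carrier G - {\<one>\<^bsub>G\<^esub>})) = k"
proof -
  let ?V = "carrier G - {\<one>\<^bsub>G\<^esub>}"
  obtain P where P: "partition_on ?V P" "card P = k"
    and arcs: "{(u, v). u \<in> ?V \<and> v \<in> ?V \<and> power_adj G u v} =
      {(u, v). \<exists>U\<in>P. \<exists>V\<in>P. U \<noteq> V \<and> u \<in> U \<and> v \<in> V}"
    using assms unfolding complete_multipartite_def verts_proper_reduced_power_graph
      arcs_ends_proper_reduced_power_graph by blast
  have sub: "U \<subseteq> ?V" if "U \<in> P" for U
    using P(1) that by (auto simp: partition_on_def)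
  have uniq: "U = V" if "U \<in> P" "V \<in> P" "u \<in> U" "u \<in> V" for u U V
    using P(1) that by (auto simp: partition_on_def disjoint_def)
  have adj: "power_adj G u v \<longleftrightarrow> U \<noteq> V" if "U \<in> P" "V \<in> P" "u \<in> U" "v \<in> V" for u v U V
  proof -
    have "power_adj G u v \<longleftrightarrow> (u, v) \<in> {(u, v). u \<in> ?V \<and> v \<in> ?V \<and> power_adj G u v}"
      using sub that by auto
    also have "\<dots> \<longleftrightarrow> (\<exists>U\<in>P. \<exists>V\<in>P. U \<noteq> V \<and> u \<in> U \<and> v \<in> V)"
      unfolding arcs by simp
    also have "\<dots> \<longleftrightarrow> U \<noteq> V"
      using uniq[OF _ that(1) _ that(3)] uniq[OF _ that(2) _ that(4)] that by metis
    finally show ?thesis .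
  qed
  have cover: "\<exists>U\<in>P. u \<in> U" if "u \<in> ?V" for u
    using P(1) that by (auto simp: partition_on_def)
  have nn: "non_neighbours G u = U" if "U \<in> P" "u \<in> U" for u U
  proof (intro equalityI subsetI)
    fix v assume v: "v \<in> non_neighbours G u"
    then obtain V where "V \<in> P" "v \<in> V"
      using cover[of v] by (auto simp: non_neighbours_def)
    then show "v \<in> U"
      using v adj[of U V u v] that by (simp add: non_neighbours_def)
  next
    fix v assume "v \<in> U"
    then show "v \<in> non_neighbours G u"
      using adj[of U U u v] sub[of U] that by (auto simp: non_neighbours_def)
  qed
  have "non_neighbours G ` ?V = P"
  proof
    show "non_neighbours G ` ?V \<subseteq> P"
      using nn cover by fastforce
    show "P \<subseteq> non_neighbours G ` ?V"
    proof
      fix U assume U: "U \<in> P"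
      then have "U \<noteq> {}"
        using P(1) by (auto simp: partition_on_def)
      then obtain u where u: "u \<in> U"
        by blast
      show "U \<in> non_neighbours G ` ?V"
        using nn[OF U u] sub[OF U] u by blast
    qed
  qed
  then show "card (non_neighbours G ` ?V) = k"
    using P(2) by simp
  show "rpg_colouring G (non_neighbours G)"
    unfolding rpg_colouring_def
  proof (intro ballI)
    fix u v assume "u \<in> ?V" "v \<in> ?V"
    then obtain U V where UV: "U \<in> P" "u \<in> U" "V \<in> P" "v \<in> V"
      using cover by meson
    then show "power_adj G u v \<longleftrightarrow> non_neighbours G u \<noteq> non_neighbours G v"
      using adj nn by metis
  qed
qed

text \<open>In particular the number of parts does not depend on the partition.\<close>

lemma colouring_imp_complete_multipartite:
  assumes fin: "finite (carrier G)" and f: "rpg_colouring G f"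
  shows "complete_multipartite k (proper_reduced_power_graph G) \<longleftrightarrow>
    card (f ` (carrier G - {\<one>\<^bsub>G\<^esub>})) = k"
proof -
  let ?V = "carrier G - {\<one>\<^bsub>G\<^esub>}"
  let ?F = "\<lambda>c. {v \<in> ?V. f v = c}"
  have adj: "power_adj G u v \<longleftrightarrow> f u \<noteq> f v" if "u \<in> ?V" "v \<in> ?V" for u v
    using f that unfolding rpg_colouring_def by blast
  have nn: "non_neighbours G u = ?F (f u)" if "u \<in> ?V" for u
    unfolding non_neighbours_def using adj that by auto
  have inj: "inj_on ?F (f ` ?V)"
    by (rule inj_onI) blast
  have "non_neighbours G ` ?V = ?F ` f ` ?V"
    unfolding image_image by (rule image_cong) (use nn in auto)
  then have card: "card (non_neighbours G ` ?V) = card (f ` ?V)"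
    using card_image[OF inj] by simp
  have "complete_multipartite (card (f ` ?V)) (proper_reduced_power_graph G)"
    unfolding complete_multipartite_def verts_proper_reduced_power_graph
      arcs_ends_proper_reduced_power_graph
  proof (intro conjI exI[of _ "?F ` f ` ?V"])
    show "graph (proper_reduced_power_graph G)"
      by (rule graph_proper_reduced_power_graph[OF fin])
    show "partition_on ?V (?F ` f ` ?V)"
      by (auto simp: partition_on_def disjoint_def)
    show "finite (?F ` f ` ?V)"
      using fin by blast
    show "card (?F ` f ` ?V) = card (f ` ?V)"
      by (rule card_image[OF inj])
    show "{(u, v). u \<in> ?V \<and> v \<in> ?V \<and> power_adj G u v} =
      {(u, v). \<exists>U\<in>?F ` f ` ?V. \<exists>V\<in>?F ` f ` ?V. U \<noteq> V \<and> u \<in> U \<and> v \<in> V}"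
    proof -
      have "(\<exists>U\<in>?F ` f ` ?V. \<exists>V\<in>?F ` f ` ?V. U \<noteq> V \<and> u \<in> U \<and> v \<in> V) \<longleftrightarrow>
          u \<in> ?V \<and> v \<in> ?V \<and> power_adj G u v" (is "?l \<longleftrightarrow> ?r") for u v
      proof
        assume ?l
        then obtain c d where cd: "u \<in> ?F c" "v \<in> ?F d" "?F c \<noteq> ?F d"
          by blast
        then have "c \<noteq> d"
          by metis
        then show ?r
          using cd(1,2) adj[of u v] by simp
      next
        assume r: ?r
        then have "u \<in> ?F (f u)" "v \<in> ?F (f v)" "u \<notin> ?F (f v)"
          using adj[of u v] by auto
        then have "?F (f u) \<noteq> ?F (f v)"
          by metis
        moreover have "?F (f u) \<in> ?F ` f ` ?V" "?F (f v) \<in> ?F ` f ` ?V"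
          using r by auto
        ultimately show ?l
          using \<open>u \<in> ?F (f u)\<close> \<open>v \<in> ?F (f v)\<close> by (intro bexI conjI)
      qed
      then show ?thesis
        by auto
    qed
  qed
  then show ?thesis
    using complete_multipartite_imp_colouring(2) card by metis
qed

section \<open>Cyclic subgroups and element orders\<close>

context group
begin

lemma subgroup_generate_singleton: "x \<in> carrier G \<Longrightarrow> subgroup (generate G {x}) G"
  by (rule generate_is_subgroup) simp

lemma generate_singleton_subset_iff:
  assumes "u \<in> carrier G" "v \<in> carrier G"
  shows "generate G {u} \<subseteq> generate G {v} \<longleftrightarrow> u \<in> generate G {v}"
  using generate_subgroup_incl[of "{u}" "generate G {v}"] subgroup_generate_singleton[OF assms(2)]
    generate.incl[of u "{u}" G] by auto

lemma mem_subgroup_coprime_powers: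
  fixes m n :: nat
  assumes H: "subgroup H G" and x: "x \<in> carrier G"
    and m: "x [^] m \<in> H" and n: "x [^] n \<in> H" and "coprime m n"
  shows "x \<in> H"
proof -
  have "coprime (int m) (int n)"
    using assms(5) by simp
  then obtain a b :: int where ab: "a * int m + b * int n = 1"
    by (metis bezout_int coprime_imp_gcd_eq_1)
  have "x = x [^] (int m * a + int n * b)"
    using x ab by (simp add: mult.commute)
  also have "\<dots> = (x [^] m) [^] a \<otimes> (x [^] n) [^] b"
    using x by (simp add: int_pow_mult int_pow_pow[symmetric] int_pow_int)
  also have "\<dots> \<in> H"
    using subgroup_int_pow_closed[OF H] m n subgroup.m_closed[OF H] by blast
  finally show ?thesis .
qed

lemma order_eq_imp_generate_eq:
  assumes "finite (carrier G)" "u \<in> carrier G" "v \<in> carrier G" 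
    and "u \<in> generate G {v}" "ord u = ord v"
  shows "generate G {u} = generate G {v}"
proof (rule card_subset_eq)
  show "finite (generate G {v})"
    using assms(1,3) generate_incl[of "{v}"] finite_subset by blast
  show "generate G {u} \<subseteq> generate G {v}"
    using generate_singleton_subset_iff assms by blast
  show "card (generate G {u}) = card (generate G {v})"
    using assms generate_pow_card by metis
qed

lemma ord_dvd_of_mem_generate:
  assumes "finite (carrier G)" "v \<in> carrier G" "u \<in> generate G {v}"
  shows "ord u dvd ord v"
proof -
  obtain k :: nat where "u = v [^] k"
    using assms generate_pow_on_finite_carrier by blast
  then show ?thesis
    using assms(2) pow_eq_id[of u "ord v"]
    by (metis nat_pow_closed nat_pow_one nat_pow_pow mult.commute pow_ord_eq_1)
qed

lemma power_adj_iff: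
  assumes "finite (carrier G)" "u \<in> carrier G" "v \<in> carrier G"
  shows "power_adj G u v \<longleftrightarrow> ord u \<noteq> ord v \<and> (u \<in> generate G {v} \<or> v \<in> generate G {u})"
proof -
  have "ord u \<noteq> ord v" if "generate G {u} \<noteq> generate G {v}"
    "u \<in> generate G {v} \<or> v \<in> generate G {u}"
    using that order_eq_imp_generate_eq assms by metis
  moreover have "generate G {u} \<noteq> generate G {v}" if "ord u \<noteq> ord v"
    using that assms generate_pow_card by metis
  ultimately show ?thesis
    unfolding power_adj_def psubset_eq using generate_singleton_subset_iff assms by metis
qed

lemma exists_power_of_ord:
  assumes "finite (carrier G)" "x \<in> carrier G" "d dvd ord x"
  shows "\<exists>z \<in> generate G {x}. ord z = d"
proof -
  have pos: "ord x > 0"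
    using assms ord_ge_1 by fastforce
  obtain e where e: "ord x = d * e"
    using assms(3) by blast
  have "ord (x [^] e) = d"
    using ord_pow[of x e] assms(2) e pos by auto
  moreover have "x [^] e \<in> generate G {x}"
    using assms generate_pow_on_finite_carrier by blast
  ultimately show ?thesis by blast
qed

text \<open>In a finite cyclic group an element \<open>x\<close> generates the subgroup
  \<open>\<langle>a\<^bsup>ord a / ord x\<^esup>\<rangle>\<close>, which depends on its order only.\<close>

lemma mem_generate_iff_ord_dvd:
  assumes "finite (carrier G)" and a: "a \<in> carrier G" and gen: "carrier G = generate G {a}"
    and u: "u \<in> carrier G" and v: "v \<in> carrier G"
  shows "u \<in> generate G {v} \<longleftrightarrow> ord u dvd ord v"
proof
  assume dvd: "ord u dvd ord v"
  have pos: "ord a > 0" 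
    using assms ord_ge_1 by fastforce
  have eq: "generate G {x} = generate G {a [^] (ord a div ord x)}" if x: "x \<in> carrier G" for x
  proof -
    have "ord x dvd ord a"
      using ord_dvd_of_mem_generate[of a x] assms x by simp
    then obtain e where e: "ord a = ord x * e" by blast
    have "ord x > 0" "e > 0" using e pos by auto
    obtain i :: nat where i: "x = a [^] i"
      using x gen a assms(1) generate_pow_on_finite_carrier by blast
    have "a [^] (i * ord x) = \<one>"
      using i x a by (metis nat_pow_pow pow_ord_eq_1)
    then have "ord a dvd i * ord x"
      using pow_eq_id a by blast
    then have "e dvd i"
      using e \<open>ord x > 0\<close> by (metis dvd_mult_cancel mult.commute)
    then obtain j where "i = e * j" by blast
    then have "x = (a [^] e) [^] j"
      using i a nat_pow_pow by simp
    then have "x \<in> generate G {a [^] e}"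
      using a assms(1) generate_pow_on_finite_carrier[of "a [^] e"] by auto
    moreover have "ord (a [^] e) = ord x"
      using ord_pow[of a e] a e \<open>e > 0\<close> by simp
    moreover have "ord a div ord x = e"
      using e \<open>ord x > 0\<close> by simp
    ultimately show ?thesis
      using order_eq_imp_generate_eq[of x "a [^] e"] assms(1) a x by simp
  qed
  have "ord v dvd ord a"
    using ord_dvd_of_mem_generate[of a v] assms by simp
  then have "ord a div ord v dvd ord a div ord u"
    using dvd pos by (metis dvd_div_mult_self dvd_triv_left div_mult_swap)
  then obtain m where m: "ord a div ord u = (ord a div ord v) * m" by blast
  have "a [^] (ord a div ord u) \<in> generate G {a [^] (ord a div ord v)}"
    unfolding m using a assms(1) generate_pow_on_finite_carrier[of "a [^] (ord a div ord v)"]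
    by (auto simp: nat_pow_pow[symmetric])
  then have "generate G {a [^] (ord a div ord u)} \<subseteq> generate G {a [^] (ord a div ord v)}"
    using generate_singleton_subset_iff a by simp
  then show "u \<in> generate G {v}"
    using eq[OF u] eq[OF v] generate_singleton_subset_iff u v by metis
qed (use assms ord_dvd_of_mem_generate in blast)


section \<open>Containments forced by a colouring\<close>

lemma mem_generate_of_ord_dvd:
  assumes fin: "finite (carrier G)" and f: "rpg_colouring G f"
    and x: "x \<in> carrier G" "x \<noteq> \<one>" and y: "y \<in> carrier G"
    and dvd: "ord x dvd ord y" and less: "ord x \<noteq> ord y"
  shows "x \<in> generate G {y}"
proof -
  have adj: "power_adj G u v \<longleftrightarrow> f u \<noteq> f v" if "u \<in> carrier G - {\<one>}" "v \<in> carrier G - {\<one>}" for u v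
    using f that unfolding rpg_colouring_def by blast
  obtain z where z: "z \<in> generate G {y}" "ord z = ord x"
    using exists_power_of_ord[OF fin y dvd] by blast
  have zc: "z \<in> carrier G"
    using z(1) generate_in_carrier[of "{y}"] y by blast
  have ne: "z \<noteq> \<one>" "y \<noteq> \<one>"
    using x z(2) dvd less ord_eq_1[of x] by auto
  \<comment> \<open>\<open>z\<close> lies in the same part as \<open>x\<close>, and \<open>z\<close> is adjacent to \<open>y\<close>.\<close>
  have "power_adj G z y"
    using power_adj_iff[OF fin zc y] z less by simp
  moreover have "\<not> power_adj G x z"
    using power_adj_iff[OF fin x(1) zc] z(2) by simp
  ultimately have "power_adj G x y"
    using adj x y zc ne by simp
  then have "x \<in> generate G {y} \<or> y \<in> generate G {x}"
    using power_adj_iff[OF fin x(1) y] by simp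
  then show ?thesis
    using ord_dvd_of_mem_generate[OF fin x(1)] dvd less dvd_antisym by blast
qed

lemma prime_ord_mem_generate:
  assumes fin: "finite (carrier G)" and f: "rpg_colouring G f"
    and x: "x \<in> carrier G" "x \<noteq> \<one>" "\<not> prime (ord x)" and y: "y \<in> carrier G" "prime (ord y)"
  shows "y \<in> generate G {x}"
proof -
  have adj: "power_adj G u v \<longleftrightarrow> f u \<noteq> f v" if "u \<in> carrier G - {\<one>}" "v \<in> carrier G - {\<one>}" for u v
    using f that unfolding rpg_colouring_def by blast
  have not1: "ord x \<noteq> 1"
    using x ord_eq_1 by simp
  then obtain q where q: "prime q" "q dvd ord x"
    using prime_factor_nat by blast
  obtain z where z: "z \<in> generate G {x}" "ord z = q"
    using exists_power_of_ord[OF fin x(1) q(2)] by blast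
  have zc: "z \<in> carrier G"
    using z(1) generate_in_carrier[of "{x}"] x by blast
  have ne: "z \<noteq> \<one>" "y \<noteq> \<one>"
    using q(1) z(2) y(2) by auto
  have incomparable: "\<not> power_adj G y z"
  proof
    assume "power_adj G y z"
    then have "ord y \<noteq> ord z" "ord y dvd ord z \<or> ord z dvd ord y"
      using power_adj_iff[OF fin y(1) zc] ord_dvd_of_mem_generate[OF fin] y(1) zc by auto
    then show False
      using y(2) q(1) z(2) primes_dvd_imp_eq by metis
  qed
  have "power_adj G z x"
    using power_adj_iff[OF fin zc x(1)] z q x(3) by auto
  then have "power_adj G y x"
    using incomparable adj x y(1) zc ne by simp
  then have "ord y \<noteq> ord x" "y \<in> generate G {x} \<or> x \<in> generate G {y}"
    using power_adj_iff[OF fin y(1) x(1)] by auto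
  then show ?thesis
    using ord_dvd_of_mem_generate[OF fin y(1)] y(2) not1
    by (metis One_nat_def prime_nat_iff)
qed

lemma cyclic_of_ord_prod_two_primes:
  fixes p q :: nat
  assumes fin: "finite (carrier G)" and f: "rpg_colouring G f"
    and x: "x \<in> carrier G" and pq: "prime p" "prime q" "p \<noteq> q" "p * q dvd ord x"
  shows "\<exists>a \<in> carrier G. carrier G = generate G {a} \<and> ord a = p * q"
proof -
  obtain a where a: "a \<in> generate G {x}" "ord a = p * q"
    using exists_power_of_ord[OF fin x pq(4)] by blast
  have ac: "a \<in> carrier G"
    using a(1) generate_in_carrier[of "{x}"] x by blast
  have "ord a \<noteq> 1" 
    using pq a(2) by auto
  then have a1: "a \<noteq> \<one>"
    using ord_eq_1 ac by blast
  have a_np: "\<not> prime (ord a)"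
    unfolding a(2) using pq by (metis dvd_triv_left dvd_triv_right primes_dvd_imp_eq)
  \<comment> \<open>The order of \<open>a\<close> is not prime, so \<open>\<langle>a\<rangle>\<close> contains every element of prime order.\<close>
  have prime_in: "y \<in> generate G {a}" if "y \<in> carrier G" "prime (ord y)" for y
    using prime_ord_mem_generate[OF fin f ac a1 a_np] that by blast
  have only: "ord y = p \<or> ord y = q" if "y \<in> carrier G" "prime (ord y)" for y
  proof -
    have "ord y dvd p * q"
      using ord_dvd_of_mem_generate[OF fin ac prime_in[OF that]] a(2) by simp
    then show ?thesis
      using that(2) pq by (metis prime_dvd_mult_iff primes_dvd_imp_eq)
  qed
  have dvd_np: "s dvd ord w"
    if w: "w \<in> carrier G" "w \<noteq> \<one>" "\<not> prime (ord w)" and s: "s = p \<or> s = q" for w s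
  proof -
    have "s dvd ord a" "prime s"
      using s a(2) pq by auto
    then obtain y where "y \<in> generate G {a}" "ord y = s"
      using exists_power_of_ord[OF fin ac] by blast
    moreover from this have "y \<in> carrier G"
      using generate_in_carrier[of "{a}"] ac by blast
    ultimately show ?thesis
      using prime_ord_mem_generate[OF fin f w, of y] ord_dvd_of_mem_generate[OF fin w(1), of y] \<open>prime s\<close>
      by simp
  qed
  have squarefree: "\<not> r * r dvd ord w" if w: "w \<in> carrier G" and r: "prime r" for w r
  proof
    assume "r * r dvd ord w"
    then obtain z where z: "z \<in> generate G {w}" "ord z = r * r"
      using exists_power_of_ord[OF fin w] by blast
    have zc: "z \<in> carrier G"
      using z(1) generate_in_carrier[of "{w}"] w by blast
    have "\<not> prime (ord z)"
      using z(2) r prime_product not_prime_1 by metis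
    moreover have "z \<noteq> \<one>"
      using z(2) r by auto
    ultimately have "p dvd r * r" "q dvd r * r"
      using dvd_np[of z] zc z(2) by auto
    then show False
      using pq r by (metis prime_dvd_mult_iff primes_dvd_imp_eq)
  qed
  have "w \<in> generate G {a}" if w: "w \<in> carrier G" for w
  proof -
    consider "w = \<one>" | "prime (ord w)" | "w \<noteq> \<one>" "\<not> prime (ord w)"
      by blast
    then show ?thesis
    proof cases
      case 1
      then show ?thesis
        using generate.one by blast
    next
      case 2
      then show ?thesis
        using prime_in w by blast
    next
      case 3
      have "coprime p q"
        using pq primes_coprime by blast
      moreover have "p dvd ord w" "q dvd ord w"
        using dvd_np w 3 by blast+
      ultimately have "p * q dvd ord w"
        by (rule divides_mult[rotated 2])
      then obtain m where m: "ord w = p * q * m"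
        by blast
      have "m = 1"
      proof (rule ccontr)
        assume "m \<noteq> 1"
        then obtain r where r: "prime r" "r dvd m"
          using prime_factor_nat by blast
        then have "r dvd ord w"
          using m by simp
        then obtain z where z: "z \<in> generate G {w}" "ord z = r"
          using exists_power_of_ord[OF fin w] by blast
        have "z \<in> carrier G"
          using z(1) generate_in_carrier[of "{w}"] w by blast
        then have "r = p \<or> r = q"
          using only z(2) r(1) by blast
        moreover have "p * p dvd ord w" if "r = p"
          using m r that by (auto simp: mult.commute mult.left_commute)
        moreover have "q * q dvd ord w" if "r = q"
          using m r that by (auto simp: mult.commute mult.left_commute)
        ultimately show False
          using squarefree w pq by blast
      qed
      then have ordw: "ord w = p * q"
        using m by simp
      \<comment> \<open>\<open>w\<close> is recovered from its powers of prime order \<open>q\<close> and \<open>p\<close>.\<close>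
      have "ord (w [^] p) = q" "ord (w [^] q) = p"
        using ord_pow[of w p] ord_pow[of w q] w ordw pq by (auto simp: prime_gt_0_nat)
      then have "w [^] p \<in> generate G {a}" "w [^] q \<in> generate G {a}"
        using prime_in w pq by auto
      then show ?thesis
        using mem_subgroup_coprime_powers[OF subgroup_generate_singleton[OF ac] w _ _ \<open>coprime p q\<close>]
        by blast
    qed
  qed
  then have "carrier G = generate G {a}"
    using generate_in_carrier[of "{a}"] ac by blast
  then show ?thesis
    using ac a(2) by blast
qed

lemma prime_power_if_only_prime_divisor:
  fixes n p :: nat
  assumes "n > 0" "prime p" "\<And>q. prime q \<Longrightarrow> q dvd n \<Longrightarrow> q = p"
  shows "\<exists>i. n = p ^ i"
proof -
  have "n \<noteq> 0" "\<not> is_unit p"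
    using assms by auto
  then obtain m where m: "n = p ^ multiplicity p n * m" "\<not> p dvd m"
    using multiplicity_decompose'[of n p] by blast
  have "m = 1"
  proof (rule ccontr)
    assume "m \<noteq> 1"
    then obtain q where "prime q" "q dvd m"
      using prime_factor_nat by blast
    then show False
      using assms(3)[of q] m by (metis dvd_mult)
  qed
  then show ?thesis
    using m by auto
qed

lemma colouring_dichotomy:
  assumes fin: "finite (carrier G)" and f: "rpg_colouring G f"
    and x: "x \<in> carrier G" "x \<noteq> \<one>" "\<not> prime (ord x)"
  shows "(\<exists>p q. prime p \<and> prime q \<and> p \<noteq> q \<and>
            (\<exists>a \<in> carrier G. carrier G = generate G {a} \<and> ord a = p * q)) \<or>
         (\<exists>p. prime p \<and> (\<forall>w \<in> carrier G. \<exists>i. ord w = p ^ i))"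
proof (cases "\<exists>w \<in> carrier G. \<exists>p q. prime p \<and> prime q \<and> p \<noteq> q \<and> p dvd ord w \<and> q dvd ord w")
  case True
  then obtain w p q where w: "w \<in> carrier G" "prime p" "prime q" "p \<noteq> q" "p dvd ord w" "q dvd ord w"
    by blast
  then have "p * q dvd ord w"
    using primes_coprime divides_mult by blast
  then show ?thesis
    using cyclic_of_ord_prod_two_primes[OF fin f w(1-4)] w by blast
next
  case False
  have "ord x \<noteq> 1"
    using x ord_eq_1 by simp
  then obtain p where p: "prime p" "p dvd ord x"
    using prime_factor_nat by blast
  have "\<exists>i. ord w = p ^ i" if w: "w \<in> carrier G" for w
  proof (rule prime_power_if_only_prime_divisor)
    show "ord w > 0"
      using ord_ge_1[OF fin w] by simp
    show "prime p" by fact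
    fix q :: nat assume q: "prime q" "q dvd ord w"
    then obtain z where z: "z \<in> generate G {w}" "ord z = q"
      using exists_power_of_ord[OF fin w] by blast
    have "z \<in> carrier G"
      using z(1) generate_in_carrier[of "{w}"] w by blast
    then have "z \<in> generate G {x}"
      using prime_ord_mem_generate[OF fin f x] z q by simp
    then have "q dvd ord x"
      using ord_dvd_of_mem_generate[OF fin x(1)] z by blast
    then show "q = p"
      using False x(1) p q(1) by blast
  qed
  then show ?thesis
    using p(1) by blast
qed

text \<open>From left to right the generator is the image of the residue \<open>1\<close>, which belongs to the
  carrier \<open>{0..<n}\<close> because \<open>n > 1\<close>.\<close>

lemma iso_integer_mod_group_iff:
  assumes "n > 1"
  shows "G \<cong> integer_mod_group n \<longleftrightarrow>
    finite (carrier G) \<and> (\<exists>a \<in> carrier G. carrier G = generate G {a} \<and> ord a = n)"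
proof
  interpret Z: group "integer_mod_group n"
    by simp
  assume "G \<cong> integer_mod_group n"
  then have "integer_mod_group n \<cong> G"
    by (rule iso_sym)
  then obtain h where h: "h \<in> hom (integer_mod_group n) G"
    and bij: "bij_betw h (carrier (integer_mod_group n)) (carrier G)"
    by (auto simp: is_iso_def iso_def)
  have Zc: "carrier (integer_mod_group n) = {0..<int n}"
    using assms by (simp add: carrier_integer_mod_group)
  have fin: "finite (carrier G)" and card: "card (carrier G) = n"
    using bij_betw_finite[OF bij] bij_betw_same_card[OF bij] Zc by simp_all
  have one: "1 \<in> carrier (integer_mod_group n)"
    using assms by simp
  define a where "a = h 1"
  have a: "a \<in> carrier G"
    unfolding a_def using h one by (simp add: hom_carrier hom_in_carrier)
  have "h i \<in> generate G {a}" if i: "i \<in> {0..<int n}" for i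
  proof -
    interpret H: group_hom "integer_mod_group n" G h
      using h by (simp add: group_hom_def group_hom_axioms_def)
    have "h i = h (1 [^]\<^bsub>integer_mod_group n\<^esub> nat i)"
      using i by simp
    also have "\<dots> = a [^] nat i"
      unfolding a_def using one H.hom_nat_pow by blast
    finally show ?thesis
      using generate_pow_on_finite_carrier[OF fin a] by blast
  qed
  then have "h ` {0..<int n} \<subseteq> generate G {a}"
    by (rule image_subsetI)
  moreover have "carrier G = h ` {0..<int n}"
    using bij_betw_imp_surj_on[OF bij] Zc by simp
  ultimately have "carrier G \<subseteq> generate G {a}"
    by simp
  then have gen: "carrier G = generate G {a}"
    using generate_in_carrier[of "{a}"] a by blast
  then have "ord a = n"
    using generate_pow_card[OF a] card by simp
  then show "finite (carrier G) \<and> (\<exists>a \<in> carrier G. carrier G = generate G {a} \<and> ord a = n)"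
    using fin a gen by blast
next
  assume "finite (carrier G) \<and> (\<exists>a \<in> carrier G. carrier G = generate G {a} \<and> ord a = n)"
  then obtain a where fin: "finite (carrier G)" and a: "a \<in> carrier G"
    and gen: "carrier G = generate G {a}" and ord: "ord a = n"
    by blast
  let ?h = "\<lambda>i::int. a [^] i"
  have Zc: "carrier (integer_mod_group n) = {0..<int n}"
    using assms by (simp add: carrier_integer_mod_group)
  have "?h \<in> hom (integer_mod_group n) G"
  proof (rule homI)
    fix x y :: int
    have "int n dvd (x + y) - (x + y) mod int n"
      by (simp add: minus_mod_eq_mult_div)
    then have "a [^] ((x + y) mod int n) = a [^] (x + y)"
      using int_pow_eq[OF a] ord by blast
    then show "a [^] (x \<otimes>\<^bsub>integer_mod_group n\<^esub> y) = a [^] x \<otimes> a [^] y"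
      using a by (simp add: int_pow_mult)
  qed (use a in simp)
  moreover have "bij_betw ?h {0..<int n} (carrier G)"
  proof -
    have inj: "inj_on ?h {0..<int n}"
    proof (rule inj_onI)
      fix x y :: int assume xy: "x \<in> {0..<int n}" "y \<in> {0..<int n}" "a [^] x = a [^] y"
      then have "int n dvd y - x"
        using int_pow_eq[OF a] ord by blast
      then have "y mod int n = x mod int n"
        by (simp add: mod_eq_dvd_iff)
      then show "x = y"
        using xy by simp
    qed
    have "card (?h ` {0..<int n}) = card (carrier G)"
      using card_image[OF inj] generate_pow_card[OF a] ord gen by simp
    then have "?h ` {0..<int n} = carrier G"
      using card_subset_eq[OF fin, of "?h ` {0..<int n}"] a by blast
    then show ?thesis
      using inj by (simp add: bij_betw_def)
  qed
  ultimately have "?h \<in> iso (integer_mod_group n) G"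
    using Zc by (simp add: iso_def)
  then have "integer_mod_group n \<cong> G"
    by (rule is_isoI)
  then show "G \<cong> integer_mod_group n"
    by (rule group.iso_sym[rotated]) simp
qed


section \<open>Finite \<open>p\<close>-groups in which orders determine containments\<close>

lemma generate_singleton_commute:
  assumes "finite (carrier G)" "s \<in> carrier G" "u \<in> generate G {s}" "v \<in> generate G {s}"
  shows "u \<otimes> v = v \<otimes> u"
proof -
  obtain i j :: nat where "u = s [^] i" "v = s [^] j"
    using assms generate_pow_on_finite_carrier by blast
  then show ?thesis
    using assms(2) by (simp add: nat_pow_mult add.commute)
qed

lemma mult_inv_cancel_left:
  assumes "g \<in> carrier G" "x \<in> carrier G"
  shows "g \<otimes> (inv g \<otimes> x) = x" "inv g \<otimes> (g \<otimes> x) = x"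
  using assms by (simp_all add: m_assoc[symmetric])

lemma conj_nat_pow:
  assumes "g \<in> carrier G" "s \<in> carrier G"
  shows "(inv g \<otimes> s \<otimes> g) [^] (k::nat) = inv g \<otimes> s [^] k \<otimes> g"
proof (induction k)
  case 0
  then show ?case using assms by simp
next
  case (Suc k)
  then show ?case
    using assms by (simp add: m_assoc mult_inv_cancel_left)
qed

lemma two_mult_sum_lessThan:
  fixes k :: nat
  shows "2 * (\<Sum>i<k. i) = k * (k - 1)"
proof (induction k)
  case (Suc k)
  then show ?case
    by (cases k) (simp_all add: algebra_simps)
qed simp

text \<open>The exponent \<open>\<Sum>i<k. i\<close> is \<open>k(k-1)/2\<close>, written without division.\<close>

lemma pow_mult_central_commutator:
  fixes k :: nat
  assumes carr: "g \<in> carrier G" "u \<in> carrier G" "c \<in> carrier G"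
    and comm: "u \<otimes> g = g \<otimes> u \<otimes> c" and cg: "c \<otimes> g = g \<otimes> c" and cu: "c \<otimes> u = u \<otimes> c"
  shows "(g \<otimes> u) [^] k = g [^] k \<otimes> u [^] k \<otimes> c [^] (\<Sum>i<k. i)"
proof -
  have ck_g: "c [^] (m::nat) \<otimes> g = g \<otimes> c [^] m" for m
    using group_commutes_pow[OF cg] carr by blast
  have ck_u: "c [^] (m::nat) \<otimes> u = u \<otimes> c [^] m" for m
    using group_commutes_pow[OF cu] carr by blast
  have uk_g: "u [^] (m::nat) \<otimes> g = g \<otimes> u [^] m \<otimes> c [^] m" for m
  proof (induction m)
    case 0
    then show ?case using carr by simp
  next
    case (Suc m)
    have "u [^] Suc m \<otimes> g = u [^] m \<otimes> g \<otimes> (u \<otimes> c)"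
      using carr comm by (simp add: m_assoc)
    also have "\<dots> = g \<otimes> u [^] m \<otimes> (c [^] m \<otimes> u) \<otimes> c"
      using carr Suc by (simp add: m_assoc)
    also have "\<dots> = g \<otimes> u [^] Suc m \<otimes> c [^] Suc m"
      using carr ck_u by (simp add: m_assoc)
    finally show ?case .
  qed
  show ?thesis
  proof (induction k)
    case 0
    then show ?case using carr by simp
  next
    case (Suc k)
    let ?T = "\<Sum>i<k. i"
    have "(g \<otimes> u) [^] Suc k = g [^] k \<otimes> u [^] k \<otimes> (c [^] ?T \<otimes> g) \<otimes> u"
      using carr Suc by (simp add: m_assoc)
    also have "\<dots> = g [^] k \<otimes> (u [^] k \<otimes> g) \<otimes> (c [^] ?T \<otimes> u)"
      using carr ck_g by (simp add: m_assoc)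
    also have "\<dots> = g [^] k \<otimes> g \<otimes> u [^] k \<otimes> (c [^] k \<otimes> u) \<otimes> c [^] ?T"
      unfolding uk_g ck_u[of ?T] using carr by (simp add: m_assoc)
    also have "\<dots> = g [^] Suc k \<otimes> u [^] Suc k \<otimes> (c [^] k \<otimes> c [^] ?T)"
      unfolding ck_u using carr by (simp add: m_assoc)
    also have "c [^] k \<otimes> c [^] ?T = c [^] (\<Sum>i<Suc k. i)"
      using carr by (simp add: nat_pow_mult add.commute)
    finally show ?case .
  qed
qed

lemma cauchy:
  assumes fin: "finite (carrier G)" and q: "prime q" "q dvd order G"
  shows "\<exists>h \<in> carrier G. ord h = q"
proof -
  obtain m where "order G = q ^ 1 * m"
    using q(2) by auto
  then obtain H where H: "subgroup H G" "card H = q"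
    using sylow_thm[OF q(1) is_group _ fin, of 1 m] by auto
  have "H \<noteq> {\<one>}"
    using H(2) q(1) by auto
  then obtain h where h: "h \<in> H" "h \<noteq> \<one>"
    using subgroup.one_closed[OF H(1)] by blast
  have hc: "h \<in> carrier G"
    using h(1) subgroup.mem_carrier[OF H(1)] by blast
  have "h [^] card H = \<one>"
    using group.pow_order_eq_1[OF subgroup_imp_group[OF H(1)], of h] h(1)
    by (simp add: order_def nat_pow_consistent[symmetric])
  then have "ord h dvd q"
    using pow_eq_id[OF hc] H(2) by simp
  then have "ord h = q"
    using q(1) h(2) ord_eq_1[OF hc] by (metis One_nat_def prime_nat_iff)
  then show ?thesis
    using hc by blast
qed

lemma prime_dvd_index_p_group:
  assumes fin: "finite (carrier G)" and p: "prime p" 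
    and ords: "\<And>w. w \<in> carrier G \<Longrightarrow> \<exists>i. ord w = p ^ i"
    and D: "subgroup D G" "D \<noteq> carrier G"
  shows "\<exists>m. order G = card D * p * m"
proof -
  have lag: "card (rcosets D) * card D = order G"
    using lagrange[OF D(1)] by simp
  have "card (rcosets D) \<noteq> 1"
  proof
    assume "card (rcosets D) = 1"
    then have "card D = card (carrier G)"
      using lag by (simp add: order_def)
    then show False
      using card_subset_eq[OF fin subgroup.subset[OF D(1)]] D(2) by blast
  qed
  then obtain q where q: "prime q" "q dvd card (rcosets D)"
    using prime_factor_nat by blast
  have "q dvd order G"
    using q(2) lag by (metis dvd_mult2)
  then obtain h where "h \<in> carrier G" "ord h = q"
    using cauchy[OF fin q(1)] by blast
  then obtain i where "q = p ^ i"
    using ords by blast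
  then have "q = p"
    using q(1) p by (metis prime_dvd_power primes_dvd_imp_eq dvd_refl)
  then show ?thesis
    using q(2) lag by (metis dvd_def mult.assoc mult.commute)
qed

text \<open>Let \<open>t = g\<^sup>-\<^sup>1 s g\<close>. If \<open>t \<notin> \<langle>s\<rangle>\<close>, the cosets \<open>\<langle>s\<rangle> t\<^sup>j\<close> with \<open>j < p\<close> are distinct
  and hence cover \<open>S\<close>. Writing \<open>g = d t\<^sup>j = d g\<^sup>-\<^sup>1 s\<^sup>j g\<close> with \<open>d \<in> \<langle>s\<rangle>\<close> gives
  \<open>g = s\<^sup>j d \<in> \<langle>s\<rangle>\<close>, so \<open>t \<in> \<langle>s\<rangle>\<close> after all.\<close>

lemma normalises_of_index_prime:
  assumes fin: "finite (carrier G)" and p: "prime p"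
    and S: "subgroup S G" and s: "s \<in> S" and card: "card S = card (generate G {s}) * p"
    and pow: "\<And>w. w \<in> carrier G \<Longrightarrow> w [^] p \<in> generate G {s}"
    and g: "g \<in> S" 
  shows "inv g \<otimes> s \<otimes> g \<in> generate G {s}"
proof (rule ccontr)
  let ?D = "generate G {s}"
  let ?t = "inv g \<otimes> s \<otimes> g"
  assume notin: "?t \<notin> ?D"
  have carr: "s \<in> carrier G" "g \<in> carrier G"
    using s g subgroup.mem_carrier[OF S] by blast+
  then have tc: "?t \<in> carrier G" by simp
  have D: "subgroup ?D G"
    using subgroup_generate_singleton carr by blast
  have DS: "?D \<subseteq> S"
    using generate_subgroup_incl[of "{s}" S] s S by blast
  have Dc: "d \<in> carrier G" if "d \<in> ?D" for d
    using that subgroup.mem_carrier[OF D] by blast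
  have tS: "?t [^] (j::nat) \<in> S" for j
  proof -
    have "?t \<in> S"
      using s g S by (simp add: subgroup.m_closed subgroup.m_inv_closed)
    then show ?thesis
      using subgroup_int_pow_closed[OF S, of ?t "int j"] by (simp add: int_pow_int)
  qed
  let ?F = "\<lambda>(d, j::nat). d \<otimes> ?t [^] j"
  \<comment> \<open>A coincidence \<open>d t\<^sup>i = d' t\<^sup>j\<close> puts \<open>t\<^bsup>j-i\<^esup>\<close> into \<open>\<langle>s\<rangle>\<close>, which also contains \<open>t\<^sup>p\<close>.\<close>
  have less: False if "d \<in> ?D" "d' \<in> ?D" "i < j" "j < p" "d \<otimes> ?t [^] i = d' \<otimes> ?t [^] j"
    for d d' and i j :: nat
  proof -
    have "d' \<otimes> ?t [^] j = d' \<otimes> ?t [^] (j - i) \<otimes> ?t [^] i"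
      using that Dc tc by (simp add: m_assoc nat_pow_mult)
    then have "d = d' \<otimes> ?t [^] (j - i)"
      using that Dc tc by simp
    then have "?t [^] (j - i) = inv d' \<otimes> d"
      using Dc that tc by (simp add: inv_solve_left)
    then have "?t [^] (j - i) \<in> ?D"
      using D that by (simp add: subgroup.m_closed subgroup.m_inv_closed)
    moreover have "coprime (j - i) p"
      using that p prime_imp_coprime[OF p, of "j - i"] nat_dvd_not_less[of "j - i" p]
      by (simp add: coprime_commute)
    ultimately show False
      using mem_subgroup_coprime_powers[OF D tc _ pow[OF tc]] notin by blast
  qed
  have inj: "inj_on ?F (?D \<times> {..<p})"
  proof (rule inj_onI, clarsimp)
    fix d d' and i j :: nat
    assume *: "d \<in> ?D" "d' \<in> ?D" "i < p" "j < p" "d \<otimes> ?t [^] i = d' \<otimes> ?t [^] j"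
    then have "i = j"
      using less[of d d' i j] less[of d' d j i] by (metis linorder_neqE_nat)
    then show "d = d' \<and> i = j"
      using * Dc tc by simp
  qed
  have "?F ` (?D \<times> {..<p}) \<subseteq> S"
    using DS tS S by (auto simp: subgroup.m_closed subset_iff)
  moreover have "card (?F ` (?D \<times> {..<p})) = card S"
    using card_image[OF inj] card by (simp add: card_cartesian_product)
  moreover have "finite S"
    using fin S subgroup.subset finite_subset by blast
  ultimately have "?F ` (?D \<times> {..<p}) = S"
    using card_subset_eq by blast
  then obtain d j where dj: "d \<in> ?D" "g = d \<otimes> ?t [^] (j::nat)"
    using g by auto
  then have "\<one> \<otimes> g = d \<otimes> (inv g \<otimes> s [^] j) \<otimes> g"
    using conj_nat_pow[OF carr(2,1)] carr Dc by (simp add: m_assoc)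
  then have "\<one> = d \<otimes> (inv g \<otimes> s [^] j)"
    using carr Dc dj(1) by (metis inv_closed m_closed nat_pow_closed one_closed right_cancel)
  then have "inv d = inv g \<otimes> s [^] j"
    using carr Dc dj(1) by (metis inv_closed inv_solve_left m_closed nat_pow_closed one_closed r_one)
  then have "g \<otimes> inv d = s [^] j"
    using carr Dc dj(1) by (simp add: inv_solve_left)
  then have "g = s [^] j \<otimes> d"
    using carr Dc dj(1) by (metis inv_solve_right nat_pow_closed)
  moreover have "s [^] j \<in> ?D"
    using generate_pow_on_finite_carrier[OF fin carr(1)] by blast
  ultimately have "g \<in> ?D"
    using D dj(1) subgroup.m_closed by fastforce
  moreover have "s \<in> ?D"
    using generate.incl[of s "{s}" G] by simp
  ultimately have "?t \<in> ?D"
    using D by (simp add: subgroup.m_closed subgroup.m_inv_closed)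
  then show False
    using notin by blast
qed


text \<open>The assumption \<open>mem\<close> is the conclusion of \<open>mem_generate_of_ord_dvd\<close>. The quaternion group
  of order \<open>8\<close> shows that the exception \<open>p = n = 2\<close> occurs.\<close>

lemma p_group_cyclic_or_exponent_four:
  assumes fin: "finite (carrier G)" and p: "prime p" and n: "n \<ge> 2"
    and y: "y \<in> carrier G" "ord y = p ^ n"
    and ords: "\<And>w. w \<in> carrier G \<Longrightarrow> \<exists>i\<le>n. ord w = p ^ i"
    and mem: "\<And>u v. \<lbrakk>u \<in> carrier G; v \<in> carrier G; ord u dvd ord v; ord u \<noteq> ord v\<rbrakk>
      \<Longrightarrow> u \<in> generate G {v}"
  shows "carrier G = generate G {y} \<or> p = 2 \<and> n = 2"
proof (rule disjCI)
  assume not: "\<not> (p = 2 \<and> n = 2)"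
  show "carrier G = generate G {y}"
  proof (rule ccontr)
    assume ne: "carrier G \<noteq> generate G {y}"
    have p1: "p > 1"
      using p prime_gt_1_nat by blast
    have below: "w \<in> generate G {v}"
      if "w \<in> carrier G" "v \<in> carrier G" "ord v = p ^ n" "ord w \<noteq> p ^ n" for w v
    proof -
      obtain i where "i \<le> n" "ord w = p ^ i"
        using ords \<open>w \<in> carrier G\<close> by blast
      then show ?thesis
        using mem[of w v] that by (simp add: le_imp_power_dvd)
    qed
    have pow_mem: "w [^] p \<in> generate G {v}"
      if w: "w \<in> carrier G" and v: "v \<in> carrier G" "ord v = p ^ n" for w v
    proof (rule below)
      show "ord (w [^] p) \<noteq> p ^ n"
      proof
        assume eq: "ord (w [^] p) = p ^ n"
        obtain i where i: "i \<le> n" "ord w = p ^ i"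
          using ords[OF w] by blast
        have "i \<noteq> 0"
        proof
          assume "i = 0"
          then have "w = \<one>"
            using i ord_eq_1[OF w] by simp
          then have "p ^ n = 1"
            using eq by simp
          then show False
            using p1 n by simp
        qed
        then have "p dvd ord w"
          using i by (simp add: dvd_power)
        then have "ord w = p * ord (w [^] p)"
          using ord_pow[of w p] w p1 by simp
        then have "p ^ i = p ^ Suc n"
          using i eq by simp
        then have "i = Suc n"
          using p1 power_inject_exp by blast
        then show False
          using i by simp
      qed
    qed (use w v in auto)
    have "subgroup (generate G {y}) G"
      using subgroup_generate_singleton y by blast
    then obtain m where "order G = card (generate G {y}) * p * m"
      using prime_dvd_index_p_group[OF fin p _ _ ne[symmetric]] ords by blast
    then have "order G = p ^ Suc n * m"
      using generate_pow_card[OF y(1)] y(2) by (simp add: mult.commute)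
    then obtain S where S: "subgroup S G" "card S = p ^ Suc n"
      using sylow_thm[OF p is_group _ fin] by blast
    \<comment> \<open>\<open>S\<close> is too large to lie in the subgroup generated by an element of order \<open>p\<^sup>n\<close>.\<close>
    have big: "\<not> S \<subseteq> generate G {v}" if v: "v \<in> carrier G" "ord v = p ^ n" for v
    proof
      assume "S \<subseteq> generate G {v}"
      moreover have "finite (generate G {v})"
        using fin generate_incl[of "{v}"] v finite_subset by blast
      ultimately have "p ^ Suc n \<le> p ^ n"
        using card_mono[of "generate G {v}" S] S(2) generate_pow_card[OF v(1)] v(2) by simp
      then show False
        using p1 by simp
    qed
    have Sc: "w \<in> carrier G" if "w \<in> S" for w
      using that subgroup.mem_carrier[OF S(1)] by blast
    obtain s where s: "s \<in> S" "s \<notin> generate G {y}"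
      using big[OF y] by blast
    have sc: "s \<in> carrier G" "ord s = p ^ n"
      using Sc s below[OF _ y, of s] by auto
    obtain g where g: "g \<in> S" "g \<notin> generate G {s}"
      using big[OF sc] by blast
    have gc: "g \<in> carrier G" "ord g = p ^ n"
      using Sc g below[OF _ sc, of g] by auto
    let ?D = "generate G {s}"
    have D: "subgroup ?D G"
      using subgroup_generate_singleton sc by blast
    have Dc: "d \<in> carrier G" if "d \<in> ?D" for d
      using that subgroup.mem_carrier[OF D] by blast
    have conj_s: "inv g \<otimes> s \<otimes> g \<in> ?D"
    proof (rule normalises_of_index_prime[OF fin p S(1) s(1) _ _ g(1)])
      show "card S = card ?D * p"
        using S(2) generate_pow_card[OF sc(1)] sc(2) by simp
    qed (use pow_mem sc in blast)
    have conj_D: "inv g \<otimes> d \<otimes> g \<in> ?D" if d: "d \<in> ?D" for d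
    proof -
      obtain k :: nat where "d = s [^] k"
        using d generate_pow_on_finite_carrier[OF fin sc(1)] by blast
      then have "inv g \<otimes> d \<otimes> g = (inv g \<otimes> s \<otimes> g) [^] int k"
        using conj_nat_pow[OF gc(1) sc(1), of k] by (simp add: int_pow_int)
      then show ?thesis
        using subgroup_int_pow_closed[OF D conj_s] by simp
    qed
    obtain j :: nat where j: "g [^] p = s [^] j"
      using pow_mem[OF gc(1) sc] generate_pow_on_finite_carrier[OF fin sc(1)] by blast
    have "p dvd j"
    proof -
      have pn: "p ^ n = p * p ^ (n - 1)"
        using n by (simp flip: power_Suc)
      have "(s [^] j) [^] (p ^ (n - 1)) = g [^] (p ^ n)"
        unfolding j[symmetric] pn using gc by (simp add: nat_pow_pow)
      also have "\<dots> = \<one>"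
        using gc pow_ord_eq_1[of g] by simp
      finally have "s [^] (j * p ^ (n - 1)) = \<one>"
        using sc by (simp add: nat_pow_pow)
      then have "p * p ^ (n - 1) dvd j * p ^ (n - 1)"
        using pow_eq_id[OF sc(1)] sc(2) pn by simp
      then show ?thesis
        using p1 by simp
    qed
    then obtain m where m: "j = m * p"
      by (metis dvd_def mult.commute)
    \<comment> \<open>Now \<open>g\<^sup>p = (s\<^sup>m)\<^sup>p\<close>, so \<open>u = s\<^bsup>-m\<^esup>\<close> makes \<open>g\<^sup>p u\<^sup>p\<close> vanish.\<close>
    define u where "u = inv (s [^] m)"
    have uD: "u \<in> ?D"
      unfolding u_def using D generate_pow_on_finite_carrier[OF fin sc(1)]
      by (intro subgroup.m_inv_closed) auto
    then have uc: "u \<in> carrier G"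
      using Dc by blast
    have u_pow: "u [^] p = inv (g [^] p)"
      unfolding u_def j m using sc by (simp add: nat_pow_inv nat_pow_pow)
    define t where "t = inv g \<otimes> u \<otimes> g"
    have tD: "t \<in> ?D"
      unfolding t_def using conj_D uD by blast
    then have tc: "t \<in> carrier G"
      using Dc by blast
    \<comment> \<open>The commutator \<open>u\<^sup>-\<^sup>1 g\<^sup>-\<^sup>1 u g\<close>\<close>
    define c where "c = inv u \<otimes> t"
    have cD: "c \<in> ?D"
      unfolding c_def using D uD tD by (simp add: subgroup.m_closed subgroup.m_inv_closed)
    then have cc: "c \<in> carrier G"
      using Dc by blast
    have "t [^] p = inv g \<otimes> u [^] p \<otimes> g"
      unfolding t_def using conj_nat_pow gc uc by blast
    also have "\<dots> = inv g \<otimes> inv (g [^] p) \<otimes> g"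
      unfolding u_pow ..
    also have "inv g \<otimes> inv (g [^] p) = inv (g [^] p) \<otimes> inv g"
    proof -
      have "g [^] p \<otimes> g = g \<otimes> g [^] p"
        using group_commutes_pow[of g g p] gc by blast
      then have "inv (g [^] p \<otimes> g) = inv (g \<otimes> g [^] p)"
        by simp
      then show ?thesis
        using gc by (simp add: inv_mult_group)
    qed
    also have "inv (g [^] p) \<otimes> inv g \<otimes> g = u [^] p"
      unfolding u_pow using gc by (simp add: m_assoc)
    finally have t_pow: "t [^] p = u [^] p" .
    have "inv u \<in> ?D"
      using subgroup.m_inv_closed[OF D uD] .
    then have "c [^] p = inv u [^] p \<otimes> t [^] p"
      unfolding c_def using pow_mult_distrib[of "inv u" t p] tD uc tc
        generate_singleton_commute[OF fin sc(1), of "inv u" t]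
      by simp
    then have c_pow: "c [^] p = \<one>"
      unfolding t_pow using uc by (simp add: nat_pow_inv)
    have small: "k \<ge> n" if "p ^ n dvd p ^ k" for k
      using that p1 power_dvd_imp_le by blast
    have ord_c: "ord c dvd p"
      using c_pow pow_eq_id[OF cc] by simp
    \<comment> \<open>Hence \<open>c\<close> has smaller order than \<open>g\<close> and lies in \<open>\<langle>g\<rangle>\<close> as well as in \<open>\<langle>s\<rangle>\<close>.\<close>
    have "ord c \<noteq> p ^ n"
      using small[of 1] ord_c n by auto
    then have "c \<in> generate G {g}"
      using below[OF cc gc] by blast
    moreover have "g \<in> generate G {g}"
      using generate.incl[of g "{g}" G] by simp
    ultimately have cg: "c \<otimes> g = g \<otimes> c"
      using generate_singleton_commute[OF fin gc(1)] by blast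
    have cu: "c \<otimes> u = u \<otimes> c"
      using generate_singleton_commute[OF fin sc(1)] cD uD by blast
    have ug: "u \<otimes> g = g \<otimes> u \<otimes> c"
      unfolding c_def t_def using gc uc by (simp add: m_assoc mult_inv_cancel_left)
    define h where "h = g \<otimes> u"
    have hc: "h \<in> carrier G"
      unfolding h_def using gc uc by simp
    have "h \<notin> ?D"
    proof
      assume "h \<in> ?D"
      then have "h \<otimes> inv u \<in> ?D"
        using D uD by (simp add: subgroup.m_closed subgroup.m_inv_closed)
      then show False
        unfolding h_def using g gc uc by (simp add: m_assoc)
    qed
    then have ord_h: "ord h = p ^ n"
      using below[OF hc sc] by blast
    let ?T = "\<Sum>i<p. i"
    have "h [^] p = g [^] p \<otimes> u [^] p \<otimes> c [^] ?T"
      unfolding h_def by (rule pow_mult_central_commutator[OF gc(1) uc cc ug cg cu])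
    then have h_pow: "h [^] p = c [^] ?T"
      unfolding u_pow using gc cc by simp
    have "p = 2"
    proof (rule ccontr)
      assume "p \<noteq> 2"
      then have "\<not> p dvd 2"
        using p primes_dvd_imp_eq two_is_prime_nat by blast
      moreover have "p dvd 2 * ?T"
        unfolding two_mult_sum_lessThan by simp
      ultimately have "p dvd ?T"
        using p prime_dvd_mult_iff by blast
      then have "h [^] p = \<one>"
        using h_pow ord_c pow_eq_id[OF cc] dvd_trans by metis
      then show False
        using pow_eq_id[OF hc] ord_h small[of 1] n by simp
    qed
    moreover have "n = 2"
    proof -
      have "h [^] (p * p) = \<one>"
        using hc cc h_pow c_pow by (metis nat_pow_pow nat_pow_one mult.commute)
      then have "p ^ n dvd p ^ 2"
        using pow_eq_id[OF hc] ord_h by (simp add: power2_eq_square)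
      then show ?thesis
        using small n by force
    qed
    ultimately show False
      using not by blast
  qed
qed

section \<open>A characterisation of the quaternion group\<close>

text \<open>The element \<open>c\<close> plays the part of \<open>-1\<close>: it is an involution, and every element other than
  \<open>1\<close> and \<open>c\<close> squares to it. The cyclic groups of order \<open>2\<close> and \<open>4\<close> satisfy this too; with two
  further elements that generate different subgroups the group is \<^term>\<open>Q8\<close>.\<close>

definition squares_to_involution :: "'a \<Rightarrow> bool" where
  "squares_to_involution c \<longleftrightarrow> c \<in> carrier G \<and> c \<noteq> \<one> \<and> c \<otimes> c = \<one> \<and>
     (\<forall>x \<in> carrier G. x \<noteq> \<one> \<longrightarrow> x \<noteq> c \<longrightarrow> x \<otimes> x = c)"

lemma squares_to_involution_central:
  assumes "squares_to_involution c" "x \<in> carrier G"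
  shows "c \<otimes> x = x \<otimes> c"
proof (cases "x = \<one> \<or> x = c")
  case False
  then have "x \<otimes> x = c"
    using assms by (auto simp: squares_to_involution_def)
  then show ?thesis
    using assms(2) m_assoc by metis
qed (use assms in \<open>auto simp: squares_to_involution_def\<close>)

lemma squares_to_involution_anticommute:
  assumes c: "squares_to_involution c"
    and x: "x \<in> carrier G" "x \<noteq> \<one>" "x \<noteq> c" 
    and y: "y \<in> carrier G" "y \<noteq> \<one>" "y \<noteq> c" "y \<noteq> x" "y \<noteq> c \<otimes> x"
  shows "y \<otimes> x = c \<otimes> (x \<otimes> y)"
proof -
  have cc: "c \<in> carrier G" "c \<otimes> c = \<one>"
    and sq: "\<And>z. \<lbrakk>z \<in> carrier G; z \<noteq> \<one>; z \<noteq> c\<rbrakk> \<Longrightarrow> z \<otimes> z = c"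
    using c by (auto simp: squares_to_involution_def)
  have xx: "x \<otimes> x = c" and yy: "y \<otimes> y = c"
    using sq x y by auto
  have "x \<otimes> (c \<otimes> x) = \<one>"
    using squares_to_involution_central[OF c x(1)] xx cc x m_assoc by metis
  then have "x \<otimes> y \<noteq> \<one>"
    using y(5) x(1) y(1) cc(1) Units_l_cancel m_closed Units_eq by metis
  moreover have "x \<otimes> y \<noteq> c"
    using xx y(4) x(1) y(1) Units_l_cancel Units_eq by metis
  ultimately have xy: "(x \<otimes> y) \<otimes> (x \<otimes> y) = c"
    using sq x y by simp
  \<comment> \<open>Compare \<open>(xy)(xy) = c\<close> with \<open>(xx)(yy) = cc = 1\<close>.\<close>
  have "x \<otimes> (y \<otimes> x) \<otimes> y = c"
    using xy x y by (simp add: m_assoc)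
  also have "c = c \<otimes> (c \<otimes> c)"
    using cc by simp
  also have "\<dots> = c \<otimes> (x \<otimes> x \<otimes> (y \<otimes> y))"
    using xx yy by simp
  also have "\<dots> = c \<otimes> x \<otimes> (x \<otimes> y) \<otimes> y"
    using x y cc by (simp add: m_assoc)
  also have "\<dots> = x \<otimes> (c \<otimes> (x \<otimes> y)) \<otimes> y"
    using squares_to_involution_central[OF c x(1)] x y cc by (simp add: m_assoc)
  finally show ?thesis
    using x y cc by simp
qed


lemma squares_to_involution_of_ords:
  assumes fin: "finite (carrier G)" and y: "y \<in> carrier G" "ord y = 4"
    and ords: "\<And>w. w \<in> carrier G \<Longrightarrow> ord w = 1 \<or> ord w = 2 \<or> ord w = 4"
    and mem: "\<And>w. \<lbrakk>w \<in> carrier G; ord w = 2\<rbrakk> \<Longrightarrow> w \<in> generate G {y}"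
  shows "squares_to_involution (y \<otimes> y)"
proof -
  let ?c = "y \<otimes> y"
  have c2: "?c = y [^] (2::nat)"
    using y by (simp add: numeral_2_eq_2)
  have cc: "?c \<in> carrier G"
    using y by simp
  have ord_c: "ord ?c = 2"
    unfolding c2 using ord_pow[of y 2] y by simp
  have c_pow: "?c [^] k = (if even k then \<one> else ?c)" for k :: nat
  proof -
    have "?c [^] (2 * m) = \<one>" for m :: nat
      using pow_eq_id[OF cc] ord_c by simp
    then show ?thesis
      using cc by (cases "even k") (auto elim!: evenE oddE)
  qed
  have ord2: "w = ?c" if w: "w \<in> carrier G" "ord w = 2" for w
  proof -
    obtain j :: nat where j: "w = y [^] j"
      using mem[OF w] generate_pow_on_finite_carrier[OF fin y(1)] by blast
    have "w [^] (2::nat) = \<one>"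
      using w pow_eq_id by simp
    then have "ord y dvd j * 2"
      using j y pow_eq_id[OF y(1)] by (simp add: nat_pow_pow)
    then obtain k where k: "j = 2 * k"
      using y(2) by (auto simp: dvd_def)
    have "w = ?c [^] k"
      unfolding j k c2 using y by (simp add: nat_pow_pow)
    moreover have "w \<noteq> \<one>"
      using w by auto
    ultimately show ?thesis
      using c_pow by metis
  qed
  have "x \<otimes> x = ?c" if x: "x \<in> carrier G" "x \<noteq> \<one>" "x \<noteq> ?c" for x
  proof -
    have "ord x = 4"
      using ords[OF x(1)] ord_eq_1[OF x(1)] ord2[OF x(1)] x by blast
    then have "ord (x [^] (2::nat)) = 2"
      using ord_pow[of x 2] x by simp
    then show ?thesis
      using ord2[of "x [^] (2::nat)"] x by (simp add: numeral_2_eq_2)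
  qed
  moreover have "?c \<noteq> \<one>"
    using ord_c by auto
  moreover have "?c \<otimes> ?c = \<one>"
    using c_pow[of 2] cc by (simp add: numeral_2_eq_2)
  ultimately show ?thesis
    using cc by (simp add: squares_to_involution_def)
qed

lemma squares_to_involution_colouring:
  assumes fin: "finite (carrier G)" and c: "squares_to_involution c"
  shows "rpg_colouring G (\<lambda>u. u = c)"
proof -
  have cc: "c \<in> carrier G" "c \<noteq> \<one>" "c \<otimes> c = \<one>"
    and sq: "\<And>x. \<lbrakk>x \<in> carrier G; x \<noteq> \<one>; x \<noteq> c\<rbrakk> \<Longrightarrow> x \<otimes> x = c"
    using c by (auto simp: squares_to_involution_def)
  have "c [^] (2::nat) = \<one>"
    using cc by (simp add: numeral_2_eq_2)
  then have "ord c dvd 2"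
    using pow_eq_id cc by blast
  then have ord_c: "ord c = 2"
    using ord_eq_1[OF cc(1)] cc(2) by (metis One_nat_def prime_nat_iff two_is_prime_nat)
  have other: "ord x = 4 \<and> c \<in> generate G {x}" if x: "x \<in> carrier G" "x \<noteq> \<one>" "x \<noteq> c" for x
  proof
    have x2: "x [^] (2::nat) = c"
      using sq x by (simp add: numeral_2_eq_2)
    then show "c \<in> generate G {x}"
      using generate_pow_on_finite_carrier[OF fin x(1)] by blast
    have "x [^] (4::nat) = (x [^] (2::nat)) [^] (2::nat)"
      using x by (simp add: nat_pow_pow)
    then have "ord x dvd 4"
      using x2 \<open>c [^] (2::nat) = \<one>\<close> pow_eq_id[OF x(1)] by simp
    then have "ord x dvd 2 ^ 2"
      by simp
    then obtain i where i: "i \<le> 2" "ord x = 2 ^ i"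
      using divides_primepow_nat[OF two_is_prime_nat] by blast
    have "\<not> ord x dvd 2"
      using x2 cc pow_eq_id[OF x(1)] by metis
    then have "i = 2"
      using i by (cases "i = 0 \<or> i = 1") auto
    then show "ord x = 4"
      using i by simp
  qed
  have "power_adj G u v \<longleftrightarrow> (u = c) \<noteq> (v = c)"
    if u: "u \<in> carrier G" "u \<noteq> \<one>" and v: "v \<in> carrier G" "v \<noteq> \<one>" for u v
  proof -
    have "u \<noteq> c \<longrightarrow> ord u = 4 \<and> c \<in> generate G {u}" "v \<noteq> c \<longrightarrow> ord v = 4 \<and> c \<in> generate G {v}"
      using other u v by blast+
    then show ?thesis
      using power_adj_iff[OF fin u(1) v(1)] ord_c by (cases "u = c"; cases "v = c") auto
  qed
  then show ?thesis
    unfolding rpg_colouring_def by blast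
qed

lemma Q8_iso_imp_squares_to_involution:
  assumes "G \<cong> Q8"
  shows "\<exists>c y. squares_to_involution c \<and> y \<in> carrier G \<and> y \<noteq> \<one> \<and> y \<noteq> c"
proof -
  have "Q8 \<cong> G"
    using assms by (rule iso_sym)
  then obtain h where h: "h \<in> hom Q8 G" and bij: "bij_betw h (carrier Q8) (carrier G)"
    by (auto simp: is_iso_def iso_def)
  interpret H: group_hom Q8 G h
    using h group_Q8 is_group by (simp add: group_hom_def group_hom_axioms_def)
  have one: "h (1, 0, 0, 0) = \<one>"
    using H.hom_one by (simp add: Q8_def)
  let ?c = "h (-1, 0, 0, 0)"
  let ?m = "(-1, 0, 0, 0) :: int \<times> int \<times> int \<times> int"
  have inj: "h p = h q \<longleftrightarrow> p = q" if "p \<in> carrier Q8" "q \<in> carrier Q8" for p q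
    using bij that by (auto simp: bij_betw_def inj_on_def)
  have in_Q8: "?m \<in> carrier Q8" "(1, 0, 0, 0) \<in> carrier Q8" "(0, 1, 0, 0) \<in> carrier Q8"
    by (simp_all add: Q8_def)
  have sq: "q \<otimes>\<^bsub>Q8\<^esub> q = ?m" if "q \<in> carrier Q8" "q \<noteq> (1, 0, 0, 0)" "q \<noteq> ?m" for q
    using that by (auto simp: Q8_def)
  have "x \<otimes> x = ?c" if x: "x \<in> carrier G" "x \<noteq> \<one>" "x \<noteq> ?c" for x
  proof -
    have "x \<in> h ` carrier Q8"
      using x(1) bij_betw_imp_surj_on[OF bij] by simp
    then obtain q where q: "q \<in> carrier Q8" "x = h q"
      by blast
    then have "x \<otimes> x = h (q \<otimes>\<^bsub>Q8\<^esub> q)"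
      by simp
    then show ?thesis
      using sq[OF q(1)] q(2) x one by metis
  qed
  moreover have "?c \<otimes> ?c = \<one>"
  proof -
    have "?c \<otimes> ?c = h (?m \<otimes>\<^bsub>Q8\<^esub> ?m)"
      using in_Q8 by simp
    also have "?m \<otimes>\<^bsub>Q8\<^esub> ?m = (1, 0, 0, 0)"
      by (simp add: Q8_def)
    finally show ?thesis
      using one by simp
  qed
  moreover have "?c \<in> carrier G" "?c \<noteq> \<one>"
    using in_Q8 inj[of ?m "(1, 0, 0, 0)"] one by auto
  ultimately have "squares_to_involution ?c"
    by (simp add: squares_to_involution_def)
  moreover have "h (0, 1, 0, 0) \<in> carrier G" "h (0, 1, 0, 0) \<noteq> \<one>" "h (0, 1, 0, 0) \<noteq> ?c"
    using in_Q8 inj[of "(0, 1, 0, 0)" "(1, 0, 0, 0)"] inj[of "(0, 1, 0, 0)" ?m] one by auto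
  ultimately show ?thesis
    by blast
qed

lemma squares_to_involution_imp_Q8_iso:
  assumes c: "squares_to_involution c"
    and y: "y \<in> carrier G" "y \<noteq> \<one>" "y \<noteq> c"
    and z: "z \<in> carrier G" "z \<noteq> \<one>" "z \<noteq> c" "z \<noteq> y" "z \<noteq> c \<otimes> y"
  shows "G \<cong> Q8"
proof -
  have cc: "c \<in> carrier G" "c \<noteq> \<one>" "c \<otimes> c = \<one>"
    and sq: "\<And>x. \<lbrakk>x \<in> carrier G; x \<noteq> \<one>; x \<noteq> c\<rbrakk> \<Longrightarrow> x \<otimes> x = c"
    using c by (auto simp: squares_to_involution_def)
  have yy: "y \<otimes> y = c" and zz: "z \<otimes> z = c"
    using sq y z by auto
  have yc: "y \<otimes> c = c \<otimes> y" and zc: "z \<otimes> c = c \<otimes> z"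
    using squares_to_involution_central[OF c] y z by auto
  have zy: "z \<otimes> y = c \<otimes> (y \<otimes> z)"
    using squares_to_involution_anticommute[OF c y z] .
  have left: "c \<otimes> (c \<otimes> x) = x" "y \<otimes> (y \<otimes> x) = c \<otimes> x" "z \<otimes> (z \<otimes> x) = c \<otimes> x"
    "y \<otimes> (c \<otimes> x) = c \<otimes> (y \<otimes> x)" "z \<otimes> (c \<otimes> x) = c \<otimes> (z \<otimes> x)"
    "z \<otimes> (y \<otimes> x) = c \<otimes> (y \<otimes> (z \<otimes> x))" if "x \<in> carrier G" for x
    using that y(1) z(1) cc yy zz yc zc zy by (metis m_assoc m_closed l_one)+
  note carr = cc(1) y(1) z(1)
  \<comment> \<open>Rewrite rules that bring every word into the form \<open>c\<^sup>i y\<^sup>j z\<^sup>k\<close> with \<open>i, j, k \<le> 1\<close>\<close>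
  note norm = m_assoc cc(3) yy zz yc zc zy left
  have cancel: "c \<otimes> a = c \<otimes> b \<longleftrightarrow> a = b" if "a \<in> carrier G" "b \<in> carrier G" for a b
    using left(1) that by metis
  have yz_one: "y \<otimes> z \<noteq> \<one>"
  proof
    assume "y \<otimes> z = \<one>"
    then have "c \<otimes> z = y"
      using left(2)[of z] carr by simp
    then show False
      using left(1)[of z] carr z(5) by simp
  qed
  have yz_c: "y \<otimes> z \<noteq> c"
  proof
    assume "y \<otimes> z = c"
    then have "c \<otimes> z = c \<otimes> y"
      using left(2)[of z] carr yc by simp
    then show False
      using cancel carr z(4) by simp
  qed
  have all: "x \<in> {\<one>, c, y, c \<otimes> y, z, c \<otimes> z, y \<otimes> z, c \<otimes> (y \<otimes> z)}" if x: "x \<in> carrier G" for x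
  proof (rule ccontr)
    \<comment> \<open>A further \<open>x\<close> would anticommute with \<open>y\<close>, \<open>z\<close> and \<open>yz\<close>, but the first two make it commute
      with \<open>yz\<close>.\<close>
    assume not: "x \<notin> {\<one>, c, y, c \<otimes> y, z, c \<otimes> z, y \<otimes> z, c \<otimes> (y \<otimes> z)}"
    have xy: "x \<otimes> y = c \<otimes> (y \<otimes> x)" and xz: "x \<otimes> z = c \<otimes> (z \<otimes> x)"
      using squares_to_involution_anticommute[OF c] x y z not by auto
    have xyz: "x \<otimes> (y \<otimes> z) = c \<otimes> (y \<otimes> z \<otimes> x)"
      using squares_to_involution_anticommute[OF c, of "y \<otimes> z" x] x carr yz_one yz_c not by auto
    have "x \<otimes> (y \<otimes> z) = c \<otimes> (y \<otimes> (x \<otimes> z))"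
      using x carr xy by (metis m_assoc m_closed)
    also have "\<dots> = y \<otimes> z \<otimes> x"
      unfolding xz using x carr by (simp add: left m_assoc)
    finally have "c \<otimes> (y \<otimes> z \<otimes> x) = y \<otimes> z \<otimes> x"
      using xyz by simp
    then show False
      using r_cancel_one[of "y \<otimes> z \<otimes> x" c] x carr cc(2) by simp
  qed
  \<comment> \<open>The isomorphism sends \<open>i\<close> to \<open>y\<close>, \<open>j\<close> to \<open>z\<close> and \<open>-1\<close> to \<open>c\<close>; the last
      branch is meant for \<open>-k\<close>, and the values outside of \<^term>\<open>Q8\<close> are immaterial.\<close>
  define h :: "int \<times> int \<times> int \<times> int \<Rightarrow> 'a" where
    "h = (\<lambda>(a, b, d, e). if a = 1 then \<one> else if a = -1 then c
       else if b = 1 then y else if b = -1 then c \<otimes> y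
       else if d = 1 then z else if d = -1 then c \<otimes> z
       else if e = 1 then y \<otimes> z else c \<otimes> (y \<otimes> z))"
  have h_closed: "h q \<in> carrier G" for q
    by (cases q) (simp add: h_def carr)
  have h_mult: "\<forall>p \<in> carrier Q8. \<forall>q \<in> carrier Q8. h (p \<otimes>\<^bsub>Q8\<^esub> q) = h p \<otimes> h q"
    unfolding Q8_def h_def by (simp add: norm carr)
  have hom: "h \<in> hom Q8 G"
    by (rule homI) (rule h_closed, rule h_mult[rule_format])
  interpret H: group_hom Q8 G h
    using hom group_Q8 is_group by (simp add: group_hom_def group_hom_axioms_def)
  have "q = \<one>\<^bsub>Q8\<^esub>" if "q \<in> carrier Q8" "h q = \<one>" for q
    using that cc(2) y z yz_one yz_c cancel[of _ c] carr cc(3)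
    by (auto simp: Q8_def h_def split: if_splits)
  then have "inj_on h (carrier Q8)"
    using H.inj_on_one_iff by blast
  moreover have "h ` carrier Q8 = carrier G"
  proof
    show "h ` carrier Q8 \<subseteq> carrier G"
      by auto
    have "h ` carrier Q8 = {\<one>, c, y, c \<otimes> y, z, c \<otimes> z, y \<otimes> z, c \<otimes> (y \<otimes> z)}"
      by (simp add: Q8_def h_def)
    then show "carrier G \<subseteq> h ` carrier Q8"
      using all by blast
  qed
  ultimately have "h \<in> iso Q8 G"
    using hom by (simp add: iso_def bij_betw_def)
  then have "Q8 \<cong> G"
    by (rule is_isoI)
  then show ?thesis
    by (rule group.iso_sym[OF group_Q8])
qed

section \<open>Classification\<close>

lemma ord_colouring_p_group:
  assumes fin: "finite (carrier G)" and ords: "\<And>w. w \<in> carrier G \<Longrightarrow> \<exists>i. ord w = p ^ i"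
    and mem: "\<And>u v. \<lbrakk>u \<in> carrier G; v \<in> carrier G; ord u dvd ord v; ord u \<noteq> ord v\<rbrakk>
      \<Longrightarrow> u \<in> generate G {v}"
  shows "rpg_colouring G ord"
  unfolding rpg_colouring_def
proof (intro ballI)
  fix u v assume "u \<in> carrier G - {\<one>}" "v \<in> carrier G - {\<one>}"
  then have uv: "u \<in> carrier G" "v \<in> carrier G"
    by auto
  obtain i j where "ord u = p ^ i" "ord v = p ^ j"
    using ords uv by meson
  then have "ord u dvd ord v \<or> ord v dvd ord u"
    using le_imp_power_dvd nle_le by metis
  then show "power_adj G u v \<longleftrightarrow> ord u \<noteq> ord v"
    using power_adj_iff[OF fin uv] mem uv by metis
qed

lemma card_ords_p_group:
  assumes fin: "finite (carrier G)" and p: "p > 1" and y: "y \<in> carrier G" "ord y = p ^ n"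
    and ords: "\<And>w. w \<in> carrier G \<Longrightarrow> \<exists>i\<le>n. ord w = p ^ i"
  shows "card (ord ` (carrier G - {\<one>})) = n"
proof -
  have "ord ` (carrier G - {\<one>}) = (\<lambda>i. p ^ i) ` {1..n}"
  proof
    show "ord ` (carrier G - {\<one>}) \<subseteq> (\<lambda>i. p ^ i) ` {1..n}"
    proof (rule image_subsetI)
      fix w assume w: "w \<in> carrier G - {\<one>}"
      then obtain i where i: "i \<le> n" "ord w = p ^ i"
        using ords by blast
      moreover have "i \<noteq> 0"
        using i w ord_eq_1[of w] by auto
      ultimately show "ord w \<in> (\<lambda>i. p ^ i) ` {1..n}"
        by auto
    qed
    show "(\<lambda>i. p ^ i) ` {1..n} \<subseteq> ord ` (carrier G - {\<one>})"
    proof (rule image_subsetI)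
      fix i assume i: "i \<in> {1..n}"
      then have "p ^ i dvd ord y"
        using y by (simp add: le_imp_power_dvd)
      then obtain z where z: "z \<in> generate G {y}" "ord z = p ^ i"
        using exists_power_of_ord[OF fin y(1)] by blast
      have "p ^ i \<noteq> 1"
        using i p by simp
      then have "z \<noteq> \<one>"
        using z(2) ord_id by metis
      moreover have "z \<in> carrier G"
        using z(1) generate_in_carrier[of "{y}"] y by blast
      ultimately show "p ^ i \<in> ord ` (carrier G - {\<one>})"
        using z(2) by (metis Diff_iff empty_iff imageI insert_iff)
    qed
  qed
  moreover have "inj_on (\<lambda>i. p ^ i) {1..n}"
    using p by (auto simp: inj_on_def)
  ultimately show ?thesis
    using card_image by fastforce
qed

lemma cyclic_prime_power_multipartite:
  assumes fin: "finite (carrier G)" and p: "prime p"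
    and a: "a \<in> carrier G" "carrier G = generate G {a}" "ord a = p ^ n"
  shows "complete_multipartite n (proper_reduced_power_graph G)"
proof -
  have ords: "\<exists>i\<le>n. ord w = p ^ i" if "w \<in> carrier G" for w
    using ord_dvd_of_mem_generate[OF fin a(1)] that a(2,3) divides_primepow_nat[OF p] by metis
  have "rpg_colouring G ord"
    using ord_colouring_p_group[OF fin, of p] ords mem_generate_iff_ord_dvd[OF fin a(1,2)] by blast
  then show ?thesis
    using colouring_imp_complete_multipartite[OF fin]
      card_ords_p_group[OF fin _ a(1,3) ords] p prime_gt_1_nat by blast
qed

lemma cyclic_two_primes_multipartite:
  assumes fin: "finite (carrier G)" and pq: "prime p" "prime q" "p \<noteq> q"
    and a: "a \<in> carrier G" "carrier G = generate G {a}" "ord a = p * q"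
  shows "complete_bipartite (proper_reduced_power_graph G)"
proof -
  have ords: "ord w = p \<or> ord w = q \<or> ord w = p * q" if w: "w \<in> carrier G" "w \<noteq> \<one>" for w
  proof -
    have "ord w dvd p * q"
      using ord_dvd_of_mem_generate[OF fin a(1)] w a(2,3) by metis
    then obtain r s where "ord w = r * s" "r dvd p" "s dvd q"
      using dvd_productE by metis
    moreover have "ord w \<noteq> 1"
      using ord_eq_1 w by blast
    ultimately show ?thesis
      using pq by (metis One_nat_def mult_1 mult.right_neutral prime_nat_iff)
  qed
  have ndvd: "\<not> p dvd q" "\<not> q dvd p"
    using pq primes_dvd_imp_eq by blast+
  have gt: "p > 1" "q > 1"
    using pq prime_gt_1_nat by blast+
  then have ne: "p \<noteq> p * q" "q \<noteq> p * q"
    by auto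
  have "rpg_colouring G (\<lambda>u. ord u = p * q)"
    unfolding rpg_colouring_def
  proof (intro ballI)
    fix u v assume "u \<in> carrier G - {\<one>}" "v \<in> carrier G - {\<one>}"
    then have uv: "u \<in> carrier G" "u \<noteq> \<one>" "v \<in> carrier G" "v \<noteq> \<one>"
      by auto
    have "power_adj G u v \<longleftrightarrow> ord u \<noteq> ord v \<and> (ord u dvd ord v \<or> ord v dvd ord u)"
      using power_adj_iff[OF fin uv(1,3)] mem_generate_iff_ord_dvd[OF fin a(1,2)] uv by metis
    then show "power_adj G u v \<longleftrightarrow> (ord u = p * q) \<noteq> (ord v = p * q)"
      using ords[OF uv(1,2)] ords[OF uv(3,4)]
      by (elim disjE) (use gt ndvd ne pq(3) in simp_all)
  qed
  moreover have "(\<lambda>u. ord u = p * q) ` (carrier G - {\<one>}) = {True, False}"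
  proof -
    obtain z where z: "z \<in> generate G {a}" "ord z = p"
      using exists_power_of_ord[OF fin a(1), of p] a(3) by auto
    have "z \<noteq> \<one>" "a \<noteq> \<one>"
      using z a(3) pq by auto
    then have "True \<in> (\<lambda>u. ord u = p * q) ` (carrier G - {\<one>})"
      "False \<in> (\<lambda>u. ord u = p * q) ` (carrier G - {\<one>})"
      using a z ne by (auto intro!: image_eqI[of _ _ a] image_eqI[of _ _ z])
    then show ?thesis
      by auto
  qed
  ultimately show ?thesis
    using colouring_imp_complete_multipartite[OF fin] by fastforce
qed

lemma Q8_multipartite:
  assumes fin: "finite (carrier G)" and "G \<cong> Q8"
  shows "complete_bipartite (proper_reduced_power_graph G)"
proof -
  obtain c y where c: "squares_to_involution c" and y: "y \<in> carrier G" "y \<noteq> \<one>" "y \<noteq> c"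
    using Q8_iso_imp_squares_to_involution[OF assms(2)] by blast
  have "c \<in> carrier G" "c \<noteq> \<one>"
    using c by (auto simp: squares_to_involution_def)
  then have "(\<lambda>u. u = c) ` (carrier G - {\<one>}) = {True, False}"
    using y by (auto simp: image_iff)
  then show ?thesis
    using colouring_imp_complete_multipartite[OF fin squares_to_involution_colouring[OF fin c]] by simp
qed

lemma multipartite_imp_classification:
  assumes fin: "finite (carrier G)" and k: "k \<ge> 2"
    and cm: "complete_multipartite k (proper_reduced_power_graph G)"
  shows "(\<exists>p::nat. prime p \<and> G \<cong> integer_mod_group (p ^ k)) \<or>
    k = 2 \<and> ((\<exists>p q::nat. prime p \<and> prime q \<and> p \<noteq> q \<and> G \<cong> integer_mod_group (p * q)) \<or> G \<cong> Q8)"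
proof -
  define f where "f = non_neighbours G"
  have f: "rpg_colouring G f" and card_f: "card (f ` (carrier G - {\<one>})) = k"
    unfolding f_def using complete_multipartite_imp_colouring[OF cm] by auto
  have unique: "k = j" if "complete_multipartite j (proper_reduced_power_graph G)" for j
    using colouring_imp_complete_multipartite[OF fin f] that cm by metis
  have mem: "u \<in> generate G {v}"
    if "u \<in> carrier G" "v \<in> carrier G" "ord u dvd ord v" "ord u \<noteq> ord v" for u v
    using mem_generate_of_ord_dvd[OF fin f] that generate.one by metis
  have "\<exists>x \<in> carrier G. x \<noteq> \<one> \<and> \<not> prime (ord x)"
  proof (rule ccontr)
    assume "\<not> ?thesis"
    then have pr: "prime (ord x)" if "x \<in> carrier G" "x \<noteq> \<one>" for x
      using that by blast
    have "f u = f v" if u: "u \<in> carrier G - {\<one>}" and v: "v \<in> carrier G - {\<one>}" for u v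
    proof -
      have "\<not> power_adj G u v"
        using power_adj_iff[OF fin, of u v] ord_dvd_of_mem_generate[OF fin, of u v]
          ord_dvd_of_mem_generate[OF fin, of v u] pr u v primes_dvd_imp_eq
        by (metis DiffE singletonI)
      then show ?thesis
        using f u v unfolding rpg_colouring_def by blast
    qed
    then have "\<forall>a \<in> f ` (carrier G - {\<one>}). \<forall>b \<in> f ` (carrier G - {\<one>}). a = b"
      by (intro ballI, elim imageE) metis
    moreover have "finite (f ` (carrier G - {\<one>}))"
      using fin by simp
    ultimately have "card (f ` (carrier G - {\<one>})) \<le> 1"
      using card_le_Suc0_iff_eq One_nat_def by metis
    then show False
      using card_f k by simp
  qed
  then obtain x where x: "x \<in> carrier G" "x \<noteq> \<one>" "\<not> prime (ord x)"
    by blast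
  from colouring_dichotomy[OF fin f x] show ?thesis
  proof
    assume "\<exists>p q. prime p \<and> prime q \<and> p \<noteq> q \<and>
      (\<exists>a \<in> carrier G. carrier G = generate G {a} \<and> ord a = p * q)"
    then obtain p q :: nat and a where pq: "prime p" "prime q" "p \<noteq> q"
      and a: "a \<in> carrier G" "carrier G = generate G {a}" "ord a = p * q"
      by blast
    have "k = 2"
      using unique cyclic_two_primes_multipartite[OF fin pq a] by blast
    moreover have "p * q > 1"
      using less_1_mult[OF prime_gt_1_nat prime_gt_1_nat] pq by blast
    then have "G \<cong> integer_mod_group (p * q)"
      using iso_integer_mod_group_iff fin a by blast
    ultimately show ?thesis
      using pq by blast
  next
    assume "\<exists>p. prime p \<and> (\<forall>w \<in> carrier G. \<exists>i. ord w = p ^ i)"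
    then obtain p where p: "prime p" and ords: "\<And>w. w \<in> carrier G \<Longrightarrow> \<exists>i. ord w = p ^ i"
      by blast
    have p1: "p > 1"
      using p prime_gt_1_nat by blast
    have "Max (ord ` carrier G) \<in> ord ` carrier G"
      using fin x(1) by (intro Max_in) auto
    then obtain y where y: "y \<in> carrier G" "ord y = Max (ord ` carrier G)"
      by auto
    obtain n where n: "ord y = p ^ n"
      using ords y(1) by blast
    have ords_le: "\<exists>i\<le>n. ord w = p ^ i" if w: "w \<in> carrier G" for w
    proof -
      obtain i where i: "ord w = p ^ i"
        using ords w by blast
      have "ord w \<le> ord y"
        unfolding y(2) using fin w by (intro Max_ge) auto
      then show ?thesis
        using i n p1 power_le_imp_le_exp by metis
    qed
    have "complete_multipartite n (proper_reduced_power_graph G)"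
      using colouring_imp_complete_multipartite[OF fin ord_colouring_p_group[OF fin ords mem]]
        card_ords_p_group[OF fin p1 y(1) n ords_le] by blast
    then have nk: "n = k"
      using unique by simp
    have cyclic: ?thesis if "carrier G = generate G {y}"
    proof -
      have "p ^ k > 1"
        using one_less_power[OF p1] k by simp
      then have "G \<cong> integer_mod_group (p ^ k)"
        using iso_integer_mod_group_iff fin y(1) that n nk by blast
      then show ?thesis
        using p by blast
    qed
    from p_group_cyclic_or_exponent_four[OF fin p _ y(1) n ords_le mem] k nk
    consider "carrier G = generate G {y}" | "carrier G \<noteq> generate G {y}" "p = 2" "n = 2"
      by blast
    then show ?thesis
    proof cases
      case 2
      have ord_y: "ord y = 4"
        using n 2 by simp
      let ?c = "y \<otimes> y"
      have inv: "squares_to_involution ?c"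
      proof (rule squares_to_involution_of_ords[OF fin y(1) ord_y])
        fix w assume w: "w \<in> carrier G"
        obtain i where i: "i \<le> 2" "ord w = 2 ^ i"
          using ords_le[OF w] 2 by auto
        then consider "i = 0" | "i = 1" | "i = 2"
          by linarith
        then show "ord w = 1 \<or> ord w = 2 \<or> ord w = 4"
          using i(2) by cases simp_all
        show "w \<in> generate G {y}" if "ord w = 2"
          using mem[OF w y(1)] that ord_y by simp
      qed
      obtain z where z: "z \<in> carrier G" "z \<notin> generate G {y}"
        using 2 generate_in_carrier[of "{y}"] y(1) by blast
      have pow: "y [^] (i::nat) \<noteq> z" for i
        using z(2) generate_pow_on_finite_carrier[OF fin y(1)] by blast
      have "y \<noteq> \<one>"
        using ord_y by auto
      moreover have "y \<noteq> ?c"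
        using y(1) \<open>y \<noteq> \<one>\<close> by simp
      moreover have "z \<noteq> \<one>" "z \<noteq> ?c" "z \<noteq> y" "z \<noteq> ?c \<otimes> y"
        using pow[of 0] pow[of 2] pow[of 1] pow[of 3] y(1)
        by (auto simp: numeral_2_eq_2 numeral_3_eq_3)
      ultimately have "G \<cong> Q8"
        using squares_to_involution_imp_Q8_iso[OF inv y(1) _ _ z(1)] by blast
      then show ?thesis
        using nk 2 by blast
    qed (rule cyclic)
  qed
qed

end

theorem theorem2p2:
  fixes G (structure)
  assumes "group G" and "finite (carrier G)"
  shows "(complete_bipartite (proper_reduced_power_graph G) \<longleftrightarrow>
            (\<exists>p::nat. prime p \<and> G \<cong> integer_mod_group (p\<^sup>2)) \<or>
            (\<exists>p q::nat. prime p \<and> prime q \<and> p \<noteq> q \<and> G \<cong> integer_mod_group (p * q)) \<or>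
            G \<cong> Q8) \<and>
         (\<forall>k\<ge>3. complete_multipartite k (proper_reduced_power_graph G) \<longleftrightarrow>
            (\<exists>p::nat. prime p \<and> G \<cong> integer_mod_group (p ^ k)))"
proof -
  interpret group G by fact
  note fin = assms(2)
  have prime_power: "complete_multipartite k (proper_reduced_power_graph G)"
    if k: "k \<ge> 2" and p: "prime p" and iso: "G \<cong> integer_mod_group (p ^ k)" for p k :: nat
  proof -
    have "p ^ k > 1"
      using one_less_power[OF prime_gt_1_nat[OF p]] k by simp
    then show ?thesis
      using iso_integer_mod_group_iff iso cyclic_prime_power_multipartite[OF fin p] by blast
  qed
  have two_primes: "complete_bipartite (proper_reduced_power_graph G)"
    if pq: "prime p" "prime q" "p \<noteq> q" and iso: "G \<cong> integer_mod_group (p * q)" for p q :: nat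
  proof -
    have "p * q > 1"
      using less_1_mult[OF prime_gt_1_nat prime_gt_1_nat] pq by blast
    then show ?thesis
      using iso_integer_mod_group_iff iso cyclic_two_primes_multipartite[OF fin pq] by blast
  qed
  note classification = multipartite_imp_classification[OF fin]
  show ?thesis
  proof (intro conjI iffI allI impI)
    show "(\<exists>p::nat. prime p \<and> G \<cong> integer_mod_group (p\<^sup>2)) \<or>
        (\<exists>p q::nat. prime p \<and> prime q \<and> p \<noteq> q \<and> G \<cong> integer_mod_group (p * q)) \<or> G \<cong> Q8"
      if "complete_bipartite (proper_reduced_power_graph G)"
      using classification[OF _ that] by auto
    show "complete_bipartite (proper_reduced_power_graph G)"
      if "(\<exists>p::nat. prime p \<and> G \<cong> integer_mod_group (p\<^sup>2)) \<or>
        (\<exists>p q::nat. prime p \<and> prime q \<and> p \<noteq> q \<and> G \<cong> integer_mod_group (p * q)) \<or> G \<cong> Q8"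
      using that prime_power[of 2] two_primes Q8_multipartite[OF fin] by blast
    fix k :: nat assume k: "3 \<le> k"
    show "\<exists>p::nat. prime p \<and> G \<cong> integer_mod_group (p ^ k)"
      if "complete_multipartite k (proper_reduced_power_graph G)"
      using classification[OF _ that] k by auto
    show "complete_multipartite k (proper_reduced_power_graph G)"
      if "\<exists>p::nat. prime p \<and> G \<cong> integer_mod_group (p ^ k)"
      using that prime_power[of k] k by auto
  qed
qed

end
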